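(* Let $\Omega\subset\mathbb R^3$ be a region subdivided by a tetrahedral grid with barycentric dual grid, let $n$ be a node of the grid, and let $\tilde c=\tilde c_n$ be its dual cell, assumed not to intersect $\partial\Omega$. Let $m$ be the cardinality of $E(n)$ (for the first matrix below) or of $F(n)$ (for the second). Let $\tilde{\mathbb K}_{|\tilde c}$ be a symmetric positive definite matrix of order $3$. Let $\alpha=(\alpha_1,\dots,\alpha_{m-3})\in(\mathbb R^+)^{m-3}$ be any $(m-3)$-tuple of positive real numbers and let $\mathbb D_\alpha$ be the diagonal matrix with diagonal entries $\alpha_1,\dots,\alpha_{m-3}$. Let $w_{\tilde{\mathcal F}}$ and $w_{\tilde{\mathcal E}}$ be any two orthonormal bases of $\mathrm{im}(\tilde{\mathbb F}_{|\tilde c}+\mathbb S_{|\tilde c})^\perp$ and $\mathrm{im}(\tilde{\mathbb E}_{|\tilde c}+\mathbb L_{|\tilde c})^\perp$, respectively, and let $\mathbb W^{\tilde{\mathcal F}}_{|\tilde c}$ and $\mathbb W^{\tilde{\mathcal E}}_{|\tilde c}$ be the matrices whose columns are the vectors of the bases $w_{\tilde{\mathcal F}}$ and $w_{\tilde{\mathcal E}}$. Then the matrices $$\mathbb M^{\tilde{\mathcal F}}_{|\tilde c} := \frac{1}{|\tilde c|}\,\mathbb E_{|\tilde c}\,\tilde{\mathbb K}_{|\tilde c}\,\mathbb E_{|\tilde c}^T + \mathbb W^{\tilde{\mathcal F}}_{|\tilde c}\,\mathbb D_\alpha\,(\mathbb W^{\tilde{\mathcal F}}_{|\tilde c})^T,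 \qquad \mathbb M^{\tilde{\mathcal E}}_{|\tilde c} := \frac{1}{|\tilde c|}\,\mathbb F_{|\tilde c}\,\tilde{\mathbb K}_{|\tilde c}\,\mathbb F_{|\tilde c}^T + \mathbb W^{\tilde{\mathcal E}}_{|\tilde c}\,\mathbb D_\alpha\,(\mathbb W^{\tilde{\mathcal E}}_{|\tilde c})^T$$ are symmetric, consistent and positive definite.
   Context: All vectors are column vectors in $\mathbb R^3$. The grid is a (conforming) tetrahedral grid of $\Omega$ with nodes, edges, faces and cells (nondegenerate tetrahedra); each edge and face carries a fixed, arbitrarily chosen orientation. $E(n),F(n),C(n)$ are the sets of edges, faces, cells containing the node $n$; $C(e)$, $C(f)$ are the sets of cells containing the edge $e$, the face $f$. $\boldsymbol b_e,\boldsymbol b_f,\boldsymbol b_c$ are the barycenters of $e$, $f$, $c$; $\tilde{\boldsymbol n}_c=\boldsymbol b_c$. Nodes are identified with their coordinate vectors. - $\boldsymbol e$: difference of the endpoints of $e$, oriented as $e$. $\boldsymbol f=|f|\boldsymbol n_f$: area times the unit normal given by the orientation of $f$. - Dual cell: $\tilde c_n=\bigcup_{c\in C(n)}\tilde c_{n|c}$, where $\tilde c_{n|c}$ is the union of the six tetrahedra with vertices $n,\boldsymbol b_e,\boldsymbol b_f,\boldsymbol b_c$ with $n\in e\subset f\subset c$; $|\tilde c|$ is the volume of $\tilde c_n$. - $\boldsymbol e_{|\tilde c}$ and $\boldsymbol f_{|\tilde c}$ are the edge vector of $e\cap\tilde c$ and the face vector of $f\cap\tilde c$, oriented as $e$ and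 $f$. By the barycentric subdivision, $\boldsymbol e_{|\tilde c}=\tfrac12\boldsymbol e$ and $\boldsymbol f_{|\tilde c}=\tfrac13\boldsymbol f$. - Dual edge vector: $\tilde{\boldsymbol e}_f=\sum_{c\in C(f)}\tilde{\boldsymbol e}_{f|c}$, where $\tilde{\boldsymbol e}_{f|c}=\pm(\boldsymbol b_f-\tilde{\boldsymbol n}_c)$ with the sign chosen so that $\tilde{\boldsymbol e}_{f|c}\cdot\boldsymbol f>0$ ($\tilde e_{f|c}$ is the corresponding oriented segment). - Dual face vector: $\tilde{\boldsymbol f}_e=\sum_{c\in C(e)}\tilde{\boldsymbol f}_{e|c}$. Here $\tilde f_{e|c}$ is the plane quadrilateral with vertices $\tilde{\boldsymbol n}_c,\boldsymbol b_{f_1},\boldsymbol b_e,\boldsymbol b_{f_2}$, where $f_1,f_2$ are the two faces of $c$ containing $e$, and its face vector is $\tilde{\boldsymbol f}_{e|c}=\tfrac12(\boldsymbol b_{f_1}-\boldsymbol b_{f_2})\times(\boldsymbol b_e-\tilde{\boldsymbol n}_c)$, with $f_1,f_2$ ordered so that $\tilde{\boldsymbol f}_{e|c}\cdot\boldsymbol e>0$. - Boundary term $\boldsymbol s_{n,e}=\sum_{c\in C(e)}\boldsymbol s_{n,e|c}$. For $e\in E(n)$ with other endpoint $n_1$, let $\boldsymbol p_{n,e}=\tfrac34\boldsymbol n+\tfrac14\boldsymbol n_1$. For $c\in C(e)$, $s_{n,e|c}$ is the union of the triangles with vertices $\{\boldsymbol b_e,\boldsymbol b_{f_1},\boldsymbol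 p_{n,e}\}$ and $\{\boldsymbol b_e,\boldsymbol b_{f_2},\boldsymbol p_{n,e}\}$ ($f_1,f_2$ the faces of $c$ containing $e$), each oriented so that it and $\tilde f_{e|c}$ induce opposite orientations on their common edge; $\boldsymbol s_{n,e|c}$ is the sum of the two face vectors. Explicitly, with the two faces $f_1,f_2$ of $c$ containing $e$ ordered so that $\tfrac12\big((\boldsymbol b_{f_1}-\boldsymbol b_{f_2})\times(\boldsymbol b_e-\tilde{\boldsymbol n}_c)\big)\cdot\boldsymbol e>0$, $\boldsymbol s_{n,e|c}=\tfrac12(\boldsymbol b_{f_1}-\boldsymbol b_e)\times(\boldsymbol p_{n,e}-\boldsymbol b_e)+\tfrac12(\boldsymbol p_{n,e}-\boldsymbol b_e)\times(\boldsymbol b_{f_2}-\boldsymbol b_e)$. - Boundary term $\boldsymbol l_{n,f}=\sum_{c\in C(f)}\boldsymbol l_{n,f|c}$. For $f\in F(n)$ with other nodes $n_1,n_2$, let $\boldsymbol p_{n,f}=\tfrac12\boldsymbol n+\tfrac14\boldsymbol n_1+\tfrac14\boldsymbol n_2$. $l_{n,f|c}$ is the segment joining $\boldsymbol b_f$ and $\boldsymbol p_{n,f}$, oriented so that it and $\tilde e_{f|c}$ induce opposite orientations on their common node. That is, $\boldsymbol l_{n,f|c}=\boldsymbol p_{n,f}-\boldsymbol b_f$ if $\tilde{\boldsymbol e}_{f|c}=\boldsymbol b_f-\tilde{\boldsymbol n}_c$, and $\boldsymbol l_{n,f|c}=\boldsymbol b_f-\boldsymbol p_{n,f}$ if $\tilde{\boldsymbol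 e}_{f|c}=\tilde{\boldsymbol n}_c-\boldsymbol b_f$. Matrices: fix orderings of $E(n)$ and $F(n)$. $\mathbb E_{|\tilde c}$, $\tilde{\mathbb F}_{|\tilde c}$, $\mathbb S_{|\tilde c}$ have rows $\boldsymbol e_{|\tilde c}^T$, $\tilde{\boldsymbol f}_e^T$, $\boldsymbol s_{n,e}^T$, $e\in E(n)$ (same order). $\mathbb F_{|\tilde c}$, $\tilde{\mathbb E}_{|\tilde c}$, $\mathbb L_{|\tilde c}$ have rows $\boldsymbol f_{|\tilde c}^T$, $\tilde{\boldsymbol e}_f^T$, $\boldsymbol l_{n,f}^T$, $f\in F(n)$ (same order). $\mathrm{im}$ denotes the image of the matrix as a linear map $\mathbb R^3\to\mathbb R^m$, and $\perp$ the orthogonal complement in $\mathbb R^m$. Consistency: $\mathbb M^{\tilde{\mathcal F}}_{|\tilde c}$ is consistent if $\mathbb E_{|\tilde c}\boldsymbol v=\mathbb M^{\tilde{\mathcal F}}_{|\tilde c}\,\tilde{\mathbb F}_{|\tilde c}\boldsymbol u$ for all $\boldsymbol u,\boldsymbol v\in\mathbb R^3$ with $\boldsymbol v=\tilde{\mathbb K}_{|\tilde c}\boldsymbol u$. $\mathbb M^{\tilde{\mathcal E}}_{|\tilde c}$ is consistent if $\mathbb F_{|\tilde c}\boldsymbol z=\mathbb M^{\tilde{\mathcal E}}_{|\tilde c}\,\tilde{\mathbb E}_{|\tilde c}\boldsymbol w$ for all $\boldsymbol w,\boldsymbol z\in\mathbb R^3$ with $\boldsymbol z=\tilde{\mathbb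 K}_{|\tilde c}\boldsymbol w$. *)

theory Defs
  imports "HOL-Analysis.Analysis"
begin

section \<open>Tetrahedral grids\<close>

text \<open>
  A simplex (edge, face, cell) is represented by its vertex set; the geometric simplex is the
  convex hull of that set. A grid is given by its set of cells \<open>C\<close>. The conformity condition is
  the library's \<^const>\<open>triangulation\<close>: two closed cells meet in a common (possibly empty) face.
  Asking for the closure of \<open>\<Omega>\<close> allows \<open>\<Omega>\<close> to be open or closed.
\<close>

type_synonym point = "real^3"

definition tetrahedral_grid :: "point set \<Rightarrow> point set set \<Rightarrow> bool" where
  "tetrahedral_grid \<Omega> C \<longleftrightarrow>
     finite C \<and>
     (\<forall>c\<in>C. card c = 4 \<and> \<not> affine_dependent c) \<and>
     triangulation ((\<lambda>c. convex hull c) ` C) \<and>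
     closure \<Omega> = (\<Union>c\<in>C. convex hull c)"

definition grid_nodes :: "point set set \<Rightarrow> point set" where
  "grid_nodes C = \<Union>C"

definition grid_edges :: "point set set \<Rightarrow> point set set" where
  "grid_edges C = {e. card e = 2 \<and> (\<exists>c\<in>C. e \<subseteq> c)}"

definition grid_faces :: "point set set \<Rightarrow> point set set" where
  "grid_faces C = {f. card f = 3 \<and> (\<exists>c\<in>C. f \<subseteq> c)}"

definition edges_at :: "point set set \<Rightarrow> point \<Rightarrow> point set set" where
  "edges_at C n = {e \<in> grid_edges C. n \<in> e}"

definition faces_at :: "point set set \<Rightarrow> point \<Rightarrow> point set set" where
  "faces_at C n = {f \<in> grid_faces C. n \<in> f}"

text \<open>The cells containing a given simplex; for a node \<open>n\<close> take the simplex \<open>{n}\<close>.\<close>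

definition cells_at :: "point set set \<Rightarrow> point set \<Rightarrow> point set set" where
  "cells_at C s = {c \<in> C. s \<subseteq> c}"

definition barycenter :: "point set \<Rightarrow> point" where
  "barycenter s = (1 / real (card s)) *\<^sub>R (\<Sum>x\<in>s. x)"


section \<open>Orientations, edge vectors and face vectors\<close>

text \<open>
  The orientation of an edge is an ordering (tail, head) of its endpoints; the orientation of a
  face is an ordering of its vertices, which determines the unit normal by the right-hand rule.
  Orderings that differ by an even permutation yield the same face vector.
\<close>

definition edge_orientation ::
    "point set set \<Rightarrow> (point set \<Rightarrow> point \<times> point) \<Rightarrow> bool" where
  "edge_orientation C eo \<longleftrightarrow> (\<forall>e\<in>grid_edges C. case eo e of (a, b) \<Rightarrow> e = {a, b})"

definition face_orientation ::
    "point set set \<Rightarrow> (point set \<Rightarrow> point \<times> point \<times> point) \<Rightarrow> bool" where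
  "face_orientation C fo \<longleftrightarrow> (\<forall>f\<in>grid_faces C. case fo f of (x, y, z) \<Rightarrow> f = {x, y, z})"

definition edge_vec :: "(point set \<Rightarrow> point \<times> point) \<Rightarrow> point set \<Rightarrow> point" where
  "edge_vec eo e = (case eo e of (a, b) \<Rightarrow> b - a)"

definition triangle_area :: "point \<Rightarrow> point \<Rightarrow> point \<Rightarrow> real" where
  "triangle_area x y z = norm (cross3 (y - x) (z - x)) / 2"

definition triangle_normal :: "point \<Rightarrow> point \<Rightarrow> point \<Rightarrow> point" where
  "triangle_normal x y z = sgn (cross3 (y - x) (z - x))"

definition face_vec ::
    "(point set \<Rightarrow> point \<times> point \<times> point) \<Rightarrow> point set \<Rightarrow> point" where
  "face_vec fo f = (case fo f of (x, y, z) \<Rightarrow> triangle_area x y z *\<^sub>R triangle_normal x y z)"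


section \<open>The barycentric dual grid\<close>

definition dual_cell_part :: "point \<Rightarrow> point set \<Rightarrow> point set" where
  "dual_cell_part n c =
     \<Union>{convex hull {n, barycenter e, barycenter f, barycenter c} | e f.
         card e = 2 \<and> card f = 3 \<and> n \<in> e \<and> e \<subseteq> f \<and> f \<subseteq> c}"

definition dual_cell :: "point set set \<Rightarrow> point \<Rightarrow> point set" where
  "dual_cell C n = (\<Union>c\<in>cells_at C {n}. dual_cell_part n c)"

definition dual_edge_part ::
    "(point set \<Rightarrow> point \<times> point \<times> point) \<Rightarrow> point set \<Rightarrow> point set \<Rightarrow> point" where
  "dual_edge_part fo f c =
     (if (barycenter f - barycenter c) \<bullet> face_vec fo f > 0
      then barycenter f - barycenter c else barycenter c - barycenter f)"

definition dual_edge_vec ::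
    "point set set \<Rightarrow> (point set \<Rightarrow> point \<times> point \<times> point) \<Rightarrow> point set \<Rightarrow> point" where
  "dual_edge_vec C fo f = (\<Sum>c\<in>cells_at C f. dual_edge_part fo f c)"

text \<open>
  The face vector of the plane quadrilateral with vertices the barycenters of \<open>c\<close>, \<open>f1\<close>, \<open>e\<close>, \<open>f2\<close>
  (half the cross product of its diagonals).
\<close>

definition quad_vec :: "point set \<Rightarrow> point set \<Rightarrow> point set \<Rightarrow> point set \<Rightarrow> point" where
  "quad_vec e c f1 f2 =
     (1/2) *\<^sub>R cross3 (barycenter f1 - barycenter f2) (barycenter e - barycenter c)"

text \<open>
  The two faces of \<open>c\<close> containing \<open>e\<close>, ordered compatibly with the orientation of \<open>e\<close>. For a
  nondegenerate cell exactly one of the two orderings qualifies, so the choice is unique.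
\<close>

definition ordered_faces ::
    "(point set \<Rightarrow> point \<times> point) \<Rightarrow> point set \<Rightarrow> point set
      \<Rightarrow> point set \<times> point set" where
  "ordered_faces eo e c =
     (SOME (f1, f2). f1 \<noteq> f2 \<and> {f. card f = 3 \<and> e \<subseteq> f \<and> f \<subseteq> c} = {f1, f2} \<and>
        quad_vec e c f1 f2 \<bullet> edge_vec eo e > 0)"

definition dual_face_part ::
    "(point set \<Rightarrow> point \<times> point) \<Rightarrow> point set \<Rightarrow> point set \<Rightarrow> point" where
  "dual_face_part eo e c = (case ordered_faces eo e c of (f1, f2) \<Rightarrow> quad_vec e c f1 f2)"

definition dual_face_vec ::
    "point set set \<Rightarrow> (point set \<Rightarrow> point \<times> point) \<Rightarrow> point set \<Rightarrow> point" where
  "dual_face_vec C eo e = (\<Sum>c\<in>cells_at C e. dual_face_part eo e c)"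


section \<open>Boundary terms\<close>

text \<open>In \<open>edge_point\<close> the sum has one term, the other endpoint of \<open>e\<close>.\<close>

definition edge_point :: "point \<Rightarrow> point set \<Rightarrow> point" where
  "edge_point n e = (3/4) *\<^sub>R n + (1/4) *\<^sub>R (\<Sum>x\<in>e - {n}. x)"

definition face_point :: "point \<Rightarrow> point set \<Rightarrow> point" where
  "face_point n f = (1/2) *\<^sub>R n + (1/4) *\<^sub>R (\<Sum>x\<in>f - {n}. x)"

definition s_part ::
    "(point set \<Rightarrow> point \<times> point) \<Rightarrow> point \<Rightarrow> point set \<Rightarrow> point set \<Rightarrow> point" where
  "s_part eo n e c =
     (case ordered_faces eo e c of (f1, f2) \<Rightarrow>
        (1/2) *\<^sub>R cross3 (barycenter f1 - barycenter e) (edge_point n e - barycenter e) +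
        (1/2) *\<^sub>R cross3 (edge_point n e - barycenter e) (barycenter f2 - barycenter e))"

definition s_vec ::
    "point set set \<Rightarrow> (point set \<Rightarrow> point \<times> point) \<Rightarrow> point \<Rightarrow> point set \<Rightarrow> point" where
  "s_vec C eo n e = (\<Sum>c\<in>cells_at C e. s_part eo n e c)"

definition l_part ::
    "(point set \<Rightarrow> point \<times> point \<times> point) \<Rightarrow> point \<Rightarrow> point set \<Rightarrow> point set \<Rightarrow> point" where
  "l_part fo n f c =
     (if dual_edge_part fo f c = barycenter f - barycenter c
      then face_point n f - barycenter f else barycenter f - face_point n f)"

definition l_vec ::
    "point set set \<Rightarrow> (point set \<Rightarrow> point \<times> point \<times> point) \<Rightarrow> point \<Rightarrow> point set \<Rightarrow> point" where
  "l_vec C fo n f = (\<Sum>c\<in>cells_at C f. l_part fo n f c)"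


section \<open>Matrices\<close>

text \<open>
  The rows are indexed by a finite type \<open>'m\<close> through an enumeration \<open>ed\<close> of the edges (\<open>fa\<close> of the
  faces) at \<open>n\<close>. The factors 1/2 and 1/3 restrict the edge and face vectors to the dual cell: by
  the barycentric subdivision, half of each edge and a third of each face at \<open>n\<close> lie in it.
\<close>

definition edge_matrix ::
    "(point set \<Rightarrow> point \<times> point) \<Rightarrow> ('m::finite \<Rightarrow> point set) \<Rightarrow> real^3^'m" where
  "edge_matrix eo ed = (\<chi> i. (1/2) *\<^sub>R edge_vec eo (ed i))"

definition dual_face_matrix ::
    "point set set \<Rightarrow> (point set \<Rightarrow> point \<times> point) \<Rightarrow> ('m::finite \<Rightarrow> point set)
      \<Rightarrow> real^3^'m" where
  "dual_face_matrix C eo ed = (\<chi> i. dual_face_vec C eo (ed i))"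

definition s_matrix ::
    "point set set \<Rightarrow> (point set \<Rightarrow> point \<times> point) \<Rightarrow> point
      \<Rightarrow> ('m::finite \<Rightarrow> point set) \<Rightarrow> real^3^'m" where
  "s_matrix C eo n ed = (\<chi> i. s_vec C eo n (ed i))"

definition face_matrix ::
    "(point set \<Rightarrow> point \<times> point \<times> point) \<Rightarrow> ('m::finite \<Rightarrow> point set) \<Rightarrow> real^3^'m" where
  "face_matrix fo fa = (\<chi> i. (1/3) *\<^sub>R face_vec fo (fa i))"

definition dual_edge_matrix ::
    "point set set \<Rightarrow> (point set \<Rightarrow> point \<times> point \<times> point) \<Rightarrow> ('m::finite \<Rightarrow> point set)
      \<Rightarrow> real^3^'m" where
  "dual_edge_matrix C fo fa = (\<chi> i. dual_edge_vec C fo (fa i))"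

definition l_matrix ::
    "point set set \<Rightarrow> (point set \<Rightarrow> point \<times> point \<times> point) \<Rightarrow> point
      \<Rightarrow> ('m::finite \<Rightarrow> point set) \<Rightarrow> real^3^'m" where
  "l_matrix C fo n fa = (\<chi> i. l_vec C fo n (fa i))"

definition symmetric_matrix :: "real^'m^'m \<Rightarrow> bool" where
  "symmetric_matrix A \<longleftrightarrow> transpose A = A"

definition pos_def_matrix :: "real^'m^'m \<Rightarrow> bool" where
  "pos_def_matrix A \<longleftrightarrow> (\<forall>x. x \<noteq> 0 \<longrightarrow> x \<bullet> (A *v x) > 0)"

definition diag_matrix :: "real^'k \<Rightarrow> real^'k^'k" where
  "diag_matrix a = (\<chi> i j. if i = j then a $ i else 0)"

definition matrix_of_columns :: "('k \<Rightarrow> real^'m) \<Rightarrow> real^'k^'m" where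
  "matrix_of_columns w = (\<chi> i j. w j $ i)"

definition orthonormal_basis_of :: "('k \<Rightarrow> real^'m) \<Rightarrow> (real^'m) set \<Rightarrow> bool" where
  "orthonormal_basis_of w V \<longleftrightarrow>
     (\<forall>i j. w i \<bullet> w j = (if i = j then 1 else 0)) \<and> span (range w) = V"

definition consistent :: "real^3^3 \<Rightarrow> real^3^'m \<Rightarrow> real^3^'m \<Rightarrow> real^'m^'m \<Rightarrow> bool" where
  "consistent K A B M \<longleftrightarrow> (\<forall>u v. v = K *v u \<longrightarrow> A *v v = M *v (B *v u))"

end

(*
  Let E, G be the edge and dual face matrices. Two facts suffice: S = 0 and E^T G = |c| I, where |c|
  is the volume of the dual cell. Then W^T G = 0 gives consistency, and if x^T M x = 0 then E^T x = 0
  and x is orthogonal to the complement of im G, so that x = G u with 0 = E^T G u = |c| u. The faces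
  are treated in the same way.

  The contributions of a cell to S come with a sign for each of its faces that only depends on the
  side of the face on which the cell lies. A face at n has its barycenter in the dual cell, hence in
  the interior of the region; by conformity exactly one cell lies on each of its sides, and the
  signs cancel.

  So S may be added to G. In a single cell with edge vectors a, b, d at n, the dual face vector of
  the edge a plus its boundary term is (b x d) / 12 up to orientation, and summing
  a ((b x d) . u) cyclically gives det(a, b, d) u. Thus each cell contributes a quarter of its volume
  times the identity, and by barycentric subdivision a quarter of the cell lies in the dual cell.
*)

theory Submission
  imports Defs
begin

section \<open>Stabilized matrices\<close>

text \<open>The weights in \<open>edge_point\<close> and \<open>face_point\<close> are what makes
  the computation in a single cell work. Put the origin at n and let a, b, d be the edge vectors of
  the cell. Its barycenter is (a + b + d)/4 and the point on the edge a is a/4, so their difference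
  has lost its a-component. The barycenter of the edge cancels when the quadrilateral and the two
  triangles are added: what remains is half the cross product of the diagonals (b - d)/3 and -(b +
  d)/4, that is -(b x d)/12. Likewise the point on the face spanned by a and b is (a + b)/4, and the
  dual edge followed by its boundary segment telescopes to d/4, up to sign.

  The arbitrary orientation of an edge or face enters as a factor k with |k| = 1. It occurs once in
  the primal vector and once in the dual one, so it drops out of every product of the two. What
  survives is the sign of det(a, b, d), which turns the determinant into six times the volume of the
  cell.\<close>

lemma transpose_add: "transpose (A + B) = transpose A + transpose (B :: real^'a^'b)"
  by (simp add: transpose_def vec_eq_iff)

lemma transpose_diag_matrix: "transpose (diag_matrix a) = diag_matrix a"
  by (auto simp: transpose_def diag_matrix_def vec_eq_iff)

lemma inner_matrix_congruence:
  fixes A :: "real^'k^'m" and K :: "real^'k^'k"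
  shows "x \<bullet> ((A ** K ** transpose A) *v x) = (transpose A *v x) \<bullet> (K *v (transpose A *v x))"
  by (simp add: dot_lmul_matrix flip: matrix_vector_mul_assoc)

lemma inner_diag_matrix:
  fixes a :: "real^'k::finite"
  shows "y \<bullet> (diag_matrix a *v y) = (\<Sum>i\<in>UNIV. a $ i * (y $ i)\<^sup>2)"
proof -
  have "(diag_matrix a *v y) $ i = a $ i * y $ i" for i
    by (simp add: diag_matrix_def matrix_vector_mult_def if_distrib [of "\<lambda>t. t * _"] cong: if_cong)
  then show ?thesis
    by (simp add: inner_vec_def power2_eq_square algebra_simps)
qed

lemma transpose_matrix_of_columns_mult:
  "transpose (matrix_of_columns w) *v x = (\<chi> i. w i \<bullet> x)"
  by (simp add: matrix_of_columns_def transpose_def matrix_vector_mult_def inner_vec_def vec_eq_iff)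

text \<open>Applied twice: to edges with dual faces, and to faces with dual edges. The quadratic
  form of \<open>M\<close> is a sum of two nonnegative terms, and definiteness means that they
  cannot vanish together.\<close>

lemma stabilized_matrix_properties:
  fixes A B :: "real^3^'m::finite" and K :: "real^3^3" and w :: "'k::finite \<Rightarrow> real^'m"
    and vol :: real
  assumes vol: "vol > 0"
    and AB: "\<And>u. transpose A *v (B *v u) = vol *\<^sub>R u"
    and K: "symmetric_matrix K" "pos_def_matrix K"
    and \<alpha>: "\<forall>i. \<alpha> $ i > 0"
    and w: "orthonormal_basis_of w (orthogonal_comp (range ((*v) B)))"
  defines "M \<equiv> (1 / vol) *\<^sub>R (A ** K ** transpose A) +
      matrix_of_columns w ** diag_matrix \<alpha> ** transpose (matrix_of_columns w)"
  shows "symmetric_matrix M \<and> consistent K A B M \<and> pos_def_matrix M"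
proof (intro conjI)
  let ?W = "matrix_of_columns w"
  have span: "span (range w) = orthogonal_comp (range ((*v) B))"
    using w by (simp add: orthonormal_basis_of_def)
  have wB: "w i \<bullet> (B *v u) = 0" for i u
  proof -
    have "w i \<in> orthogonal_comp (range ((*v) B))"
      using span by (metis rangeI span_base)
    then show ?thesis
      by (simp add: orthogonal_comp_def orthogonal_def inner_commute)
  qed
  have Msplit: "x \<bullet> (M *v x) = (1 / vol) * ((transpose A *v x) \<bullet> (K *v (transpose A *v x))) +
      (\<Sum>i\<in>UNIV. \<alpha> $ i * (w i \<bullet> x)\<^sup>2)" for x
    unfolding M_def
    by (simp add: matrix_vector_mult_add_rdistrib inner_add_right inner_matrix_congruence inner_diag_matrix
        transpose_matrix_of_columns_mult del: transpose_matrix_vector flip: scaleR_matrix_vector_assoc)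
  show "symmetric_matrix M"
    using K(1) unfolding M_def symmetric_matrix_def
    by (simp add: transpose_add transpose_scalar matrix_transpose_mul transpose_diag_matrix matrix_mul_assoc)
  show "consistent K A B M"
    unfolding consistent_def
  proof (intro allI impI)
    fix u v assume v: "v = K *v u"
    have 0: "transpose ?W *v (B *v u) = 0"
      by (simp add: transpose_matrix_of_columns_mult wB vec_eq_iff del: transpose_matrix_vector)
    have "M *v (B *v u) = (1 / vol) *\<^sub>R (A *v (K *v (transpose A *v (B *v u))))
        + ?W *v (diag_matrix \<alpha> *v (transpose ?W *v (B *v u)))"
      unfolding M_def
      by (simp add: matrix_vector_mult_add_rdistrib del: transpose_matrix_vector
          flip: scaleR_matrix_vector_assoc matrix_vector_mul_assoc)
    also have "\<dots> = A *v v"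
      using vol by (simp add: 0 AB v matrix_vector_mult_scaleR del: transpose_matrix_vector)
    finally show "A *v v = M *v (B *v u)" ..
  qed
  show "pos_def_matrix M"
    unfolding pos_def_matrix_def
  proof (intro allI impI)
    fix x :: "real^'m" assume "x \<noteq> 0"
    have K0: "y \<bullet> (K *v y) \<ge> 0" for y
      using K(2) by (cases "y = 0") (auto simp: pos_def_matrix_def less_imp_le)
    have S0: "(\<Sum>i\<in>UNIV. \<alpha> $ i * (w i \<bullet> x)\<^sup>2) \<ge> 0"
      using \<alpha> by (intro sum_nonneg) (simp add: less_imp_le)
    show "x \<bullet> (M *v x) > 0"
    proof (cases "transpose A *v x = 0")
      case False
      then have "(transpose A *v x) \<bullet> (K *v (transpose A *v x)) > 0"
        using K(2) by (simp add: pos_def_matrix_def)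
      then show ?thesis
        using S0 vol by (simp add: Msplit add_pos_nonneg)
    next
      case True
      have "\<exists>i. w i \<bullet> x \<noteq> 0"
      proof (rule ccontr)
        assume w0: "\<nexists>i. w i \<bullet> x \<noteq> 0"
        have "orthogonal x y" if "y \<in> span (range w)" for y
          using w0 by (intro orthogonal_to_span [OF that]) (auto simp: orthogonal_def inner_commute)
        then have "x \<in> orthogonal_comp (orthogonal_comp (range ((*v) B)))"
          using span by (auto simp: orthogonal_comp_def orthogonal_commute)
        \<comment> \<open>A subspace is its own double orthogonal complement, which gives
          \<open>x\<close> a preimage under \<open>B\<close>.\<close>
        moreover have "subspace (range ((*v) B))"
          by (simp add: linear_subspace_image)
        ultimately obtain u where u: "x = B *v u"
          by (auto simp: orthogonal_comp_self)
        with True AB[of u] vol have "u = 0"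
          by simp
        with u \<open>x \<noteq> 0\<close> show False
          by simp
      qed
      then obtain i where "w i \<bullet> x \<noteq> 0" ..
      then have "0 < (\<Sum>i\<in>UNIV. \<alpha> $ i * (w i \<bullet> x)\<^sup>2)"
        using \<alpha> by (intro sum_pos2 [of _ i]) (auto simp: less_imp_le)
      then show ?thesis
        using K0[of "transpose A *v x"] vol by (simp add: Msplit True del: transpose_matrix_vector)
    qed
  qed
qed

section \<open>Tetrahedra\<close>

text \<open>The hull is a translate of the image of the standard simplex, of volume 1/6, under the
  matrix with columns a - n, b - n, d - n. For affinely dependent points both sides are 0, so
  positive volume detects a nonzero triple product.\<close>

lemma content_convex_hull_4:
  fixes n a b d :: point
  shows "measure lebesgue (convex hull {n, a, b, d}) = \<bar>cross3 (a - n) (b - n) \<bullet> (d - n)\<bar> / 6"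
proof -
  define M :: "real^3^3" where "M = transpose (vector [a - n, b - n, d - n])"
  have UN: "(Basis :: point set) = {axis 1 1, axis 2 1, axis 3 1}"
    by (auto simp: Basis_vec_def UNIV_3)
  have M: "M *v axis 1 1 = a - n" "M *v axis 2 1 = b - n" "M *v axis 3 1 = d - n"
    by (simp_all add: M_def transpose_def matrix_vector_mult_basis column_def vec_eq_iff vector_3)
  have "convex hull {n, a, b, d} = (+) n ` (\<lambda>x. M *v x) ` (convex hull (insert 0 Basis))"
    by (subst convex_hull_linear_image, simp, subst convex_hull_translation [symmetric]) (simp add: UN M)
  then have "measure lebesgue (convex hull {n, a, b, d}) =
      measure lebesgue ((\<lambda>x. M *v x) ` (convex hull (insert 0 (Basis :: point set))))"
    by (simp add: measure_translation)
  also have "\<dots> = \<bar>det M\<bar> * measure lebesgue (convex hull (insert 0 (Basis :: point set)))"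
    by (subst measure_lebesgue_linear_transformation)
       (auto simp: finite_imp_bounded_convex_hull finite_imp_compact compact_convex_hull
         intro!: fmeasurableD lmeasurable_compact)
  also have "measure lebesgue (convex hull (insert 0 (Basis :: point set))) = 1 / 6"
    using content_std_simplex[where 'a = point]
    by (simp add: fact_numeral measure_completion compact_imp_closed finite_imp_compact compact_convex_hull)
  also have "\<bar>det M\<bar> = \<bar>cross3 (a - n) (b - n) \<bullet> (d - n)\<bar>"
    by (simp add: M_def det_transpose flip: dot_cross_det) (simp add: cross3_simps)
  finally show ?thesis by simp
qed

text \<open>Four affinely independent points span the whole space, so their hull has interior
  points.\<close>

lemma measure_simplex_pos:
  fixes c :: "point set"
  assumes "card c = 4" "\<not> affine_dependent c"
  shows "measure lebesgue (convex hull c) > 0"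
proof -
  have "finite c" using assms by (simp add: aff_independent_finite)
  have "aff_dim c = 3"
    using assms aff_dim_affine_independent[of c] by simp
  moreover have "c \<noteq> {}" using assms by auto
  ultimately have "interior (convex hull c) \<noteq> {}"
    by (simp add: interior_rel_interior_gen rel_interior_eq_empty aff_dim_convex_hull)
  then have "\<not> negligible (convex hull c)"
    by (simp add: negligible_convex_interior)
  moreover have "convex hull c \<in> lmeasurable"
    using \<open>finite c\<close> by (simp add: finite_imp_compact compact_convex_hull lmeasurable_compact)
  ultimately show ?thesis
    by (metis negligible_iff_measure measure_nonneg less_eq_real_def)
qed

lemma card_4_containing:
  assumes "card c = 4" "n \<in> c"
  obtains a b d where "c = {n, a, b, d}" "distinct [n, a, b, d]"
proof -
  have "card (c - {n}) = 3" using assms by simp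
  then obtain a b d where "c - {n} = {a, b, d}" "a \<noteq> b" "b \<noteq> d" "a \<noteq> d"
    by (auto simp: card_3_iff)
  then show ?thesis using assms by (intro that[of a b d]) auto
qed

lemma triple_product_nonzero:
  fixes n a b d :: point
  assumes "card {n, a, b, d} = 4" "\<not> affine_dependent {n, a, b, d}"
  shows "cross3 (a - n) (b - n) \<bullet> (d - n) \<noteq> 0"
  using measure_simplex_pos[OF assms] by (auto simp: content_convex_hull_4)

lemma barycenter_pair: "x \<noteq> y \<Longrightarrow> barycenter {x, y} = (1/2) *\<^sub>R (x + y)"
  by (simp add: barycenter_def)

lemma barycenter_triple:
  "distinct [x, y, z] \<Longrightarrow> barycenter {x, y, z} = (1/3) *\<^sub>R (x + y + z)"
  by (simp add: barycenter_def add.assoc)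

lemma barycenter_quadruple:
  "distinct [x, y, z, w] \<Longrightarrow> barycenter {x, y, z, w} = (1/4) *\<^sub>R (x + y + z + w)"
  by (simp add: barycenter_def add.assoc)

lemma faces_of_tetrahedron_containing_edge:
  assumes "distinct [x, y, z, w]"
  shows "{f. card f = 3 \<and> {x, y} \<subseteq> f \<and> f \<subseteq> {x, y, z, w}} = {{x, y, z}, {x, y, w}}"
    (is "?L = ?R")
proof
  show "?R \<subseteq> ?L" using assms by auto
  show "?L \<subseteq> ?R"
  proof
    fix f assume "f \<in> ?L"
    then have f: "card f = 3" "{x, y} \<subseteq> f" "f \<subseteq> {x, y, z, w}" by auto
    show "f \<in> ?R"
    proof (cases "w \<in> f")
      case True
      then have "{x, y, w} \<subseteq> f" using f by simp
      moreover have "finite f" using f(3) finite_subset by blast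
      ultimately have "{x, y, w} = f" using f(1) assms by (intro card_subset_eq) auto
      then show ?thesis by simp
    next
      case False
      then have "f \<subseteq> {x, y, z}" using f(3) by auto
      then have "f = {x, y, z}" using f(1) assms by (intro card_subset_eq) auto
      then show ?thesis by simp
    qed
  qed
qed

section \<open>The contribution of a single cell\<close>

lemma quad_vec_swap: "quad_vec e c f2 f1 = - quad_vec e c f1 f2"
  by (simp add: quad_vec_def cross3_simps)

text \<open>The factor 1/24 collects 1/2 from the quadrilateral, 1/3 from the face barycenters and
  1/4 from the cell barycenter.\<close>

lemma quad_vec_tetrahedron:
  assumes "distinct [n, a, b, d]"
  shows "quad_vec {n, a} {n, a, b, d} {n, a, b} {n, a, d} =
    (1/24) *\<^sub>R (cross3 (b - n) (a - n) + cross3 (a - n) (d - n) - 2 *\<^sub>R cross3 (b - n) (d - n))"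
proof -
  have 1: "barycenter {n, a, b} - barycenter {n, a, d} = (1/3) *\<^sub>R ((b - n) - (d - n))"
    using assms by (simp add: barycenter_triple algebra_simps)
  have 2: "barycenter {n, a} - barycenter {n, a, b, d} = (1/4) *\<^sub>R ((a - n) - (b - n) - (d - n))"
    using assms by (simp add: barycenter_pair barycenter_quadruple vec_eq_iff algebra_simps)
  \<comment> \<open>Stated for arbitrary vectors, so that the edge vectors at n stay atomic instead
    of being multiplied out into the coordinates of the vertices.\<close>
  have *: "(1/2) *\<^sub>R cross3 ((1/3) *\<^sub>R (B - D)) ((1/4) *\<^sub>R (A - B - D)) =
      (1/24) *\<^sub>R (cross3 B A + cross3 A D - 2 *\<^sub>R cross3 B D)" for A B D :: point
    by (simp add: vec_eq_iff forall_3 cross3_def vector_3 field_simps)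
  show ?thesis
    unfolding quad_vec_def 1 2 by (rule *)
qed

text \<open>
  The right-hand side only sees on which side of the face \<open>{n, a, b}\<close> the cell lies. This makes the
  boundary terms of the two cells at a face cancel.
\<close>

lemma quad_vec_inner_edge:
  assumes "distinct [n, a, b, d]"
  shows "quad_vec {n, a} {n, a, b, d} {n, a, b} {n, a, d} \<bullet> (a - n) =
    - (cross3 (a - n) (barycenter {n, a, b} - barycenter {n, a}) \<bullet>
       (barycenter {n, a, b, d} - barycenter {n, a, b}))"
proof -
  have 1: "barycenter {n, a, b} - barycenter {n, a} = (1/3) *\<^sub>R (b - n) - (1/6) *\<^sub>R (a - n)"
    using assms by (simp add: barycenter_triple barycenter_pair vec_eq_iff algebra_simps)
  have 2: "barycenter {n, a, b, d} - barycenter {n, a, b} = (1/4) *\<^sub>R (d - n) - (1/12) *\<^sub>R ((a - n) + (b - n))"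
    using assms by (simp add: barycenter_triple barycenter_quadruple vec_eq_iff algebra_simps)
  define A B D where "A = a - n" and "B = b - n" and "D = d - n"
  show ?thesis
    unfolding quad_vec_tetrahedron[OF assms] 1 2 A_def[symmetric] B_def[symmetric] D_def[symmetric]
    by (simp add: cross3_simps add_divide_distrib diff_divide_distrib)
qed

text \<open>The same number in terms of the determinant of the cell: nondegeneracy makes it nonzero,
  and its sign decides the ordering of the two faces.\<close>

lemma quad_vec_inner_edge_triple:
  assumes "distinct [n, a, b, d]"
  shows "quad_vec {n, a} {n, a, b, d} {n, a, b} {n, a, d} \<bullet> (a - n) =
    - (cross3 (a - n) (b - n) \<bullet> (d - n)) / 12"
proof -
  have *: "((1/24) *\<^sub>R (cross3 B A + cross3 A D - 2 *\<^sub>R cross3 B D)) \<bullet> A = - (cross3 A B \<bullet> D) / 12"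
    for A B D :: point
    by (simp add: cross3_def vector_3 inner_vec_def sum_3 field_simps)
  show ?thesis
    unfolding quad_vec_tetrahedron[OF assms] by (rule *)
qed

lemma edge_point_pair: "n \<noteq> a \<Longrightarrow> edge_point n {n, a} = (3/4) *\<^sub>R n + (1/4) *\<^sub>R a"
  by (simp add: edge_point_def insert_Diff_if)

lemma face_point_triple:
  "distinct [n, a, b] \<Longrightarrow> face_point n {n, a, b} = (1/2) *\<^sub>R n + (1/4) *\<^sub>R (a + b)"
  by (auto simp: face_point_def insert_Diff_if)

text \<open>Exchanging the faces negates the quadrilateral vector, and its product with the edge
  vector is nonzero, so one of the two orderings satisfies the description behind
  \<open>SOME\<close>. The factor \<open>k\<close> is 1 if the edge points away from n and -1
  otherwise.\<close>

lemma ordered_faces_obtain: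
  assumes "distinct [n, a, b, d]" "\<not> affine_dependent {n, a, b, d}"
    and ev: "edge_vec eo {n, a} = k *\<^sub>R (a - n)" "\<bar>k\<bar> = 1"
  obtains f1 f2 where "ordered_faces eo {n, a} {n, a, b, d} = (f1, f2)"
    "f1 = {n, a, b} \<and> f2 = {n, a, d} \<or> f1 = {n, a, d} \<and> f2 = {n, a, b}"
    "quad_vec {n, a} {n, a, b, d} f1 f2 \<bullet> edge_vec eo {n, a} > 0"
proof -
  let ?e = "{n, a}" and ?c = "{n, a, b, d}"
  have "cross3 (a - n) (b - n) \<bullet> (d - n) \<noteq> 0"
    using assms by (intro triple_product_nonzero) auto
  then have "quad_vec ?e ?c {n, a, b} {n, a, d} \<bullet> edge_vec eo ?e \<noteq> 0"
    using ev(2) by (auto simp: ev(1) quad_vec_inner_edge_triple[OF assms(1)])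
  moreover have "quad_vec ?e ?c {n, a, d} {n, a, b} \<bullet> edge_vec eo ?e =
      - (quad_vec ?e ?c {n, a, b} {n, a, d} \<bullet> edge_vec eo ?e)"
    unfolding quad_vec_swap[of ?e ?c "{n, a, d}"] by simp
  ultimately have pos: "quad_vec ?e ?c {n, a, b} {n, a, d} \<bullet> edge_vec eo ?e > 0 \<or>
      quad_vec ?e ?c {n, a, d} {n, a, b} \<bullet> edge_vec eo ?e > 0"
    by linarith
  let ?P = "\<lambda>(f1, f2). f1 \<noteq> f2 \<and> {f. card f = 3 \<and> ?e \<subseteq> f \<and> f \<subseteq> ?c} = {f1, f2} \<and>
        quad_vec ?e ?c f1 f2 \<bullet> edge_vec eo ?e > 0"
  have faces: "{f. card f = 3 \<and> ?e \<subseteq> f \<and> f \<subseteq> ?c} = {{n, a, b}, {n, a, d}}"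
    by (rule faces_of_tetrahedron_containing_edge[OF assms(1)])
  have ne: "{n, a, b} \<noteq> {n, a, d}"
    using assms(1) by auto
  have "\<exists>p. ?P p"
    using pos
  proof
    assume "quad_vec ?e ?c {n, a, b} {n, a, d} \<bullet> edge_vec eo ?e > 0"
    then show ?thesis using faces ne by (intro exI[of _ "({n, a, b}, {n, a, d})"]) simp
  next
    assume "quad_vec ?e ?c {n, a, d} {n, a, b} \<bullet> edge_vec eo ?e > 0"
    then show ?thesis using faces ne
      by (intro exI[of _ "({n, a, d}, {n, a, b})"]) (simp add: insert_commute)
  qed
  then have P: "?P (ordered_faces eo ?e ?c)"
    unfolding ordered_faces_def by (rule someI_ex)
  obtain f1 f2 where f: "ordered_faces eo ?e ?c = (f1, f2)"
    by fastforce
  show thesis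
  proof (rule that[OF f])
    show "f1 = {n, a, b} \<and> f2 = {n, a, d} \<or> f1 = {n, a, d} \<and> f2 = {n, a, b}"
      using P ne unfolding f faces by (auto simp: doubleton_eq_iff)
    show "quad_vec ?e ?c f1 f2 \<bullet> edge_vec eo ?e > 0"
      using P unfolding f by simp
  qed
qed

text \<open>Isolates the dependence on the cell: the vector after each sign is determined by n, the
  edge and the face. The first face in the chosen order has sign -1 and the second +1, which matches
  the opposite directions in which the two triangles are traversed.\<close>

lemma s_part_signed_sum:
  assumes "distinct [n, a, b, d]" "\<not> affine_dependent {n, a, b, d}"
    and ev: "edge_vec eo {n, a} = k *\<^sub>R (a - n)" "\<bar>k\<bar> = 1"
  defines "e \<equiv> {n, a}" and "c \<equiv> {n, a, b, d}"
  shows "s_part eo n e c =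
    - (\<Sum>f | card f = 3 \<and> e \<subseteq> f \<and> f \<subseteq> c.
        sgn (cross3 (edge_vec eo e) (barycenter f - barycenter e) \<bullet> (barycenter c - barycenter f)) *\<^sub>R
        ((1/2) *\<^sub>R cross3 (barycenter f - barycenter e) (edge_point n e - barycenter e)))"
proof -
  obtain f1 f2 where f: "ordered_faces eo e c = (f1, f2)"
    "f1 = {n, a, b} \<and> f2 = {n, a, d} \<or> f1 = {n, a, d} \<and> f2 = {n, a, b}"
    "quad_vec e c f1 f2 \<bullet> edge_vec eo e > 0"
    using ordered_faces_obtain[OF assms(1-4)] unfolding e_def c_def by blast
  have c': "{n, a, d, b} = c" and dist': "distinct [n, a, d, b]"
    using assms(1) by (auto simp: c_def)
  have 1: "quad_vec e c {n, a, b} {n, a, d} \<bullet> edge_vec eo e =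
     - (cross3 (edge_vec eo e) (barycenter {n, a, b} - barycenter e) \<bullet> (barycenter c - barycenter {n, a, b}))"
    using quad_vec_inner_edge[OF assms(1)] by (simp add: e_def c_def ev(1) cross_mult_left)
  have 2: "quad_vec e c {n, a, d} {n, a, b} \<bullet> edge_vec eo e =
     - (cross3 (edge_vec eo e) (barycenter {n, a, d} - barycenter e) \<bullet> (barycenter c - barycenter {n, a, d}))"
    using quad_vec_inner_edge[OF dist'] unfolding e_def c' by (simp add: ev(1) cross_mult_left)
  have neg: "cross3 (edge_vec eo e) (barycenter f1 - barycenter e) \<bullet> (barycenter c - barycenter f1) < 0"
    using f(2,3) 1 2 by auto
  have pos: "cross3 (edge_vec eo e) (barycenter f2 - barycenter e) \<bullet> (barycenter c - barycenter f2) > 0"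
    using f(2,3) 1 2 quad_vec_swap[of e c f1 f2] by auto
  have faces: "{f. card f = 3 \<and> e \<subseteq> f \<and> f \<subseteq> c} = {f1, f2}"
    using f(2) faces_of_tetrahedron_containing_edge[OF assms(1)] unfolding e_def c_def by auto
  have ne: "f1 \<noteq> f2"
    using f(2) assms(1) by auto
  show ?thesis
    unfolding faces s_part_def f(1) using ne neg pos
    by (simp add: cross_skew[of "edge_point n e - barycenter e"])
qed

text \<open>All cross products with a - n cancel. The value belongs to the faces in the order listed
  here, which need not be the one picked by \<open>ordered_faces\<close>; the other order is
  obtained by exchanging b and d.\<close>

lemma dual_face_boundary_tetrahedron:
  assumes "distinct [n, a, b, d]"
  defines "e \<equiv> {n, a}" and "f1 \<equiv> {n, a, b}" and "f2 \<equiv> {n, a, d}"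
  shows "quad_vec e {n, a, b, d} f1 f2 +
    ((1/2) *\<^sub>R cross3 (barycenter f1 - barycenter e) (edge_point n e - barycenter e) +
     (1/2) *\<^sub>R cross3 (edge_point n e - barycenter e) (barycenter f2 - barycenter e)) =
    - (1/12) *\<^sub>R cross3 (b - n) (d - n)"
proof -
  have 1: "barycenter f1 - barycenter e = (1/3) *\<^sub>R (b - n) - (1/6) *\<^sub>R (a - n)"
    using assms by (simp add: barycenter_triple barycenter_pair vec_eq_iff algebra_simps)
  have 2: "barycenter f2 - barycenter e = (1/3) *\<^sub>R (d - n) - (1/6) *\<^sub>R (a - n)"
    using assms by (simp add: barycenter_triple barycenter_pair vec_eq_iff algebra_simps)
  have 3: "edge_point n e - barycenter e = - (1/4) *\<^sub>R (a - n)"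
    using assms by (simp add: edge_point_pair barycenter_pair vec_eq_iff algebra_simps)
  have *: "(1/24) *\<^sub>R (cross3 B A + cross3 A D - 2 *\<^sub>R cross3 B D) +
    ((1/2) *\<^sub>R cross3 ((1/3) *\<^sub>R B - (1/6) *\<^sub>R A) (- (1/4) *\<^sub>R A) +
     (1/2) *\<^sub>R cross3 (- (1/4) *\<^sub>R A) ((1/3) *\<^sub>R D - (1/6) *\<^sub>R A)) =
    - (1/12) *\<^sub>R cross3 B D" for A B D :: point
    by (simp add: vec_eq_iff forall_3 cross3_def vector_3 field_simps)
  show ?thesis
    unfolding 1 2 3 unfolding e_def f1_def f2_def quad_vec_tetrahedron[OF assms(1)] by (rule *)
qed

lemma triple_product_cyclic:
  "cross3 x y \<bullet> z = cross3 y z \<bullet> x"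
  by (simp add: cross3_def vector_3 inner_vec_def sum_3 algebra_simps)

text \<open>The right-hand side is free of \<open>k\<close> because k * k = 1. It is also symmetric
  in b and d: exchanging them negates both the sign and the cross product.\<close>

lemma edge_cell_contribution:
  assumes "distinct [n, a, b, d]" "\<not> affine_dependent {n, a, b, d}"
    and ev: "edge_vec eo {n, a} = k *\<^sub>R (a - n)" "\<bar>k\<bar> = 1"
  defines "e \<equiv> {n, a}" and "c \<equiv> {n, a, b, d}"
  shows "((dual_face_part eo e c + s_part eo n e c) \<bullet> u) *\<^sub>R edge_vec eo e =
    (sgn (cross3 (a - n) (b - n) \<bullet> (d - n)) / 12 * (cross3 (b - n) (d - n) \<bullet> u)) *\<^sub>R (a - n)"
proof -
  obtain f1 f2 where f: "ordered_faces eo e c = (f1, f2)"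
    "f1 = {n, a, b} \<and> f2 = {n, a, d} \<or> f1 = {n, a, d} \<and> f2 = {n, a, b}"
    "quad_vec e c f1 f2 \<bullet> edge_vec eo e > 0"
    using ordered_faces_obtain[OF assms(1-4)] unfolding e_def c_def by blast
  have c': "{n, a, d, b} = c" and dist': "distinct [n, a, d, b]"
    using assms(1) by (auto simp: c_def)
  let ?t = "cross3 (a - n) (b - n) \<bullet> (d - n)"
  have k: "edge_vec eo e = k *\<^sub>R (a - n)" "k = 1 \<or> k = -1"
    using ev by (auto simp: e_def)
  have swap1: "cross3 (d - n) (b - n) = - cross3 (b - n) (d - n)"
    by (rule cross_skew)
  have swap: "cross3 (a - n) (d - n) \<bullet> (b - n) = - ?t"
    by (simp add: triple_product_cyclic[of "a - n"] triple_product_cyclic[of "d - n"] swap1)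
  \<comment> \<open>The sign of \<open>k * ?t\<close> reveals the order chosen by
    \<open>ordered_faces\<close>: negative for the listed one, positive for the exchanged
    one.\<close>
  have val: "dual_face_part eo e c + s_part eo n e c = (k * sgn ?t / 12) *\<^sub>R cross3 (b - n) (d - n)"
    using f(2)
  proof
    assume ff: "f1 = {n, a, b} \<and> f2 = {n, a, d}"
    have "k * ?t < 0"
      using f(3) ff quad_vec_inner_edge_triple[OF assms(1)] by (simp add: e_def[symmetric] c_def[symmetric] k(1))
    then have "k * sgn ?t = -1"
      using k(2) by (auto simp: sgn_if)
    moreover have "dual_face_part eo e c + s_part eo n e c = - (1/12) *\<^sub>R cross3 (b - n) (d - n)"
      using dual_face_boundary_tetrahedron[OF assms(1)] ff
      by (simp add: dual_face_part_def s_part_def f(1) e_def[symmetric] c_def[symmetric])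
    ultimately show ?thesis by simp
  next
    assume ff: "f1 = {n, a, d} \<and> f2 = {n, a, b}"
    have q: "quad_vec e c f1 f2 \<bullet> (a - n) = ?t / 12"
      using ff quad_vec_inner_edge_triple[OF dist'] by (simp add: e_def[symmetric] c' swap)
    have "k * ?t > 0"
      using f(3) unfolding k(1) inner_scaleR_right q by simp
    then have "k * sgn ?t = 1"
      using k(2) by (auto simp: sgn_if)
    moreover have "dual_face_part eo e c + s_part eo n e c = (1/12) *\<^sub>R cross3 (b - n) (d - n)"
      using dual_face_boundary_tetrahedron[OF dist'] ff
      by (simp add: dual_face_part_def s_part_def f(1) e_def[symmetric] c' swap1)
    ultimately show ?thesis by simp
  qed
  show ?thesis
    using k(2) unfolding val k(1) by auto
qed

section \<open>Face vectors and dual edges in a single cell\<close>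

lemma face_vec_eq: "fo f = (x, y, z) \<Longrightarrow> face_vec fo f = (1/2) *\<^sub>R cross3 (y - x) (z - x)"
  by (simp add: face_vec_def triangle_area_def triangle_normal_def sgn_div_norm divide_simps)

lemma set3_eq_cases:
  assumes "distinct [n, a, b]" "{n, a, b} = {x, y, z}"
  shows "(x, y, z) \<in> {(n, a, b), (a, b, n), (b, n, a), (n, b, a), (b, a, n), (a, n, b)}"
proof -
  have "card {x, y, z} = 3"
    using assms(1) unfolding assms(2)[symmetric] by simp
  then have "x \<noteq> y" "y \<noteq> z" "x \<noteq> z"
    by (auto simp: card_insert_if split: if_splits)
  moreover have "x \<in> {n, a, b}" "y \<in> {n, a, b}" "z \<in> {n, a, b}"
    unfolding assms(2) by auto
  ultimately show ?thesis by auto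
qed

text \<open>The three even orderings of the vertices give k = 1, the three odd ones k = -1.\<close>

lemma face_vec_sign:
  assumes "distinct [n, a, b]" "case fo {n, a, b} of (x, y, z) \<Rightarrow> {n, a, b} = {x, y, z}"
  obtains k where "face_vec fo {n, a, b} = (k / 2) *\<^sub>R cross3 (a - n) (b - n)" "\<bar>k\<bar> = 1"
proof -
  obtain x y z where xyz: "fo {n, a, b} = (x, y, z)"
    using prod_cases3 by blast
  with assms have "{n, a, b} = {x, y, z}" by simp
  then have xyz_cases: "(x, y, z) \<in> {(n, a, b), (a, b, n), (b, n, a), (n, b, a), (b, a, n), (a, n, b)}"
    by (rule set3_eq_cases[OF assms(1)])
  have cyc: "cross3 (b - a) (n - a) = cross3 (a - n) (b - n)" "cross3 (n - b) (a - b) = cross3 (a - n) (b - n)"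
    "cross3 (b - n) (a - n) = - cross3 (a - n) (b - n)" "cross3 (a - b) (n - b) = - cross3 (a - n) (b - n)"
    "cross3 (n - a) (b - a) = - cross3 (a - n) (b - n)"
    by (simp_all add: vec_eq_iff forall_3 cross3_def vector_3 algebra_simps)
  have "cross3 (y - x) (z - x) = 1 *\<^sub>R cross3 (a - n) (b - n) \<or>
      cross3 (y - x) (z - x) = (-1) *\<^sub>R cross3 (a - n) (b - n)"
    using xyz_cases by (elim insertE emptyE) (simp_all add: cyc)
  then obtain k :: real where "\<bar>k\<bar> = 1" "cross3 (y - x) (z - x) = k *\<^sub>R cross3 (a - n) (b - n)"
    using abs_1 abs_minus by metis
  then show thesis
    by (intro that[of k]) (simp_all add: face_vec_eq[of fo, OF xyz])
qed

text \<open>Rewritten with the difference pointing from the face to the cell, so that the sign tells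
  the side of the face on which the cell lies.\<close>

lemma dual_edge_part_eq:
  assumes "face_vec fo f \<bullet> (barycenter c - barycenter f) \<noteq> 0"
  shows "dual_edge_part fo f c =
    sgn (face_vec fo f \<bullet> (barycenter c - barycenter f)) *\<^sub>R (barycenter c - barycenter f)"
  using assms by (auto simp: dual_edge_part_def inner_commute inner_diff_right sgn_if)

text \<open>\<open>l_part\<close> tests an equality of vectors. The two candidates for the dual edge
  differ, since otherwise the barycenters of the cell and the face would coincide, so the test
  recovers the sign of \<open>dual_edge_part_eq\<close>.\<close>

lemma l_part_eq:
  assumes "face_vec fo f \<bullet> (barycenter c - barycenter f) \<noteq> 0"
  shows "l_part fo n f c =
    sgn (face_vec fo f \<bullet> (barycenter c - barycenter f)) *\<^sub>R (barycenter f - face_point n f)"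
proof -
  have "barycenter c - barycenter f \<noteq> barycenter f - barycenter c"
  proof
    assume eq: "barycenter c - barycenter f = barycenter f - barycenter c"
    have "2 *\<^sub>R (barycenter c - barycenter f) =
        (barycenter c - barycenter f) + (barycenter f - barycenter c)"
      unfolding scaleR_2 by (subst (2) eq) simp
    then show False
      using assms by simp
  qed
  then show ?thesis
    using assms unfolding l_part_def dual_edge_part_eq[OF assms] by (auto simp: sgn_if)
qed

lemma barycenter_cell_minus_face:
  assumes "distinct [n, a, b, d]"
  shows "barycenter {n, a, b, d} - barycenter {n, a, b} = (1/12) *\<^sub>R (3 *\<^sub>R (d - n) - (a - n) - (b - n))"
  using assms by (simp add: barycenter_triple barycenter_quadruple vec_eq_iff field_simps)

text \<open>The dual edge and its boundary segment carry the same sign, so they telescope to (d -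
  n)/4; the factor 1/2 of the face vector makes this 1/8.\<close>

lemma face_cell_contribution:
  assumes "distinct [n, a, b, d]" "\<not> affine_dependent {n, a, b, d}"
    and fo: "case fo {n, a, b} of (x, y, z) \<Rightarrow> {n, a, b} = {x, y, z}"
  defines "f \<equiv> {n, a, b}" and "c \<equiv> {n, a, b, d}"
  shows "((dual_edge_part fo f c + l_part fo n f c) \<bullet> u) *\<^sub>R face_vec fo f =
    (sgn (cross3 (a - n) (b - n) \<bullet> (d - n)) / 8 * ((d - n) \<bullet> u)) *\<^sub>R cross3 (a - n) (b - n)"
proof -
  let ?t = "cross3 (a - n) (b - n) \<bullet> (d - n)"
  have t0: "?t \<noteq> 0"
    using assms by (intro triple_product_nonzero) auto
  obtain k where k: "face_vec fo f = (k / 2) *\<^sub>R cross3 (a - n) (b - n)" "\<bar>k\<bar> = 1"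
    using face_vec_sign[of n a b fo] fo assms(1) unfolding f_def by auto
  \<comment> \<open>The normal is orthogonal to A and B, so only the component along D
    counts.\<close>
  have *: "((k / 2) *\<^sub>R cross3 A B) \<bullet> ((1/12) *\<^sub>R (3 *\<^sub>R D - A - B)) = k / 8 * (cross3 A B \<bullet> D)"
    for A B D :: point
    by (simp add: inner_diff_right dot_cross_self)
  have side: "face_vec fo f \<bullet> (barycenter c - barycenter f) = k * ?t / 8"
    unfolding k(1) unfolding f_def c_def barycenter_cell_minus_face[OF assms(1)]
    by (simp only: *)
  have side0: "face_vec fo f \<bullet> (barycenter c - barycenter f) \<noteq> 0"
    using t0 k(2) unfolding side by auto
  have sgn: "sgn (k * ?t / 8) = k * sgn ?t"
    using k(2) by (auto simp: sgn_if abs_if split: if_splits)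
  have "barycenter c - barycenter f + (barycenter f - face_point n f) = (1/4) *\<^sub>R (d - n)"
    using assms by (simp add: barycenter_quadruple face_point_triple vec_eq_iff field_simps)
  then have "dual_edge_part fo f c + l_part fo n f c = sgn (k * ?t / 8) *\<^sub>R ((1/4) *\<^sub>R (d - n))"
    using dual_edge_part_eq[OF side0] l_part_eq[OF side0, of n] unfolding side
    by (metis scaleR_right_distrib)
  then have "dual_edge_part fo f c + l_part fo n f c = (k * sgn ?t / 4) *\<^sub>R (d - n)"
    unfolding sgn by simp
  moreover have "k * k = 1"
    using k(2) by (auto simp: abs_if split: if_splits)
  ultimately show ?thesis
    by (simp add: k(1))
qed

text \<open>Cramer's rule without division: up to the determinant, the three cross products form the
  basis dual to x, y, z, and u is expanded in x, y, z.\<close>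

lemma triple_product_expansion:
  fixes x y z u :: point
  shows "(cross3 y z \<bullet> u) *\<^sub>R x + (cross3 z x \<bullet> u) *\<^sub>R y + (cross3 x y \<bullet> u) *\<^sub>R z =
    (cross3 x y \<bullet> z) *\<^sub>R u"
  by (simp add: vec_eq_iff forall_3 cross3_def vector_3 inner_vec_def sum_3 algebra_simps)

text \<open>The companion identity, expanding u in the dual basis.\<close>

lemma triple_product_dual_expansion:
  fixes x y z u :: point
  shows "(x \<bullet> u) *\<^sub>R cross3 y z + (y \<bullet> u) *\<^sub>R cross3 z x + (z \<bullet> u) *\<^sub>R cross3 x y =
    (cross3 x y \<bullet> z) *\<^sub>R u"
  by (simp add: vec_eq_iff forall_3 cross3_def vector_3 inner_vec_def sum_3 algebra_simps)

lemma edges_of_tetrahedron_at_node: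
  assumes "distinct [n, a, b, d]"
  shows "{e. card e = 2 \<and> n \<in> e \<and> e \<subseteq> {n, a, b, d}} = {{n, a}, {n, b}, {n, d}}"
proof -
  have "e \<in> {{n, a}, {n, b}, {n, d}}" if e: "card e = 2" "n \<in> e" "e \<subseteq> {n, a, b, d}" for e
  proof -
    obtain x where "e = {n, x}" "x \<noteq> n"
      using e(1,2) by (auto simp: card_2_iff)
    then show ?thesis
      using e(3) by auto
  qed
  then show ?thesis
    using assms by auto
qed

text \<open>A face of the tetrahedron is the complement of one vertex, and for a face at n that
  vertex is a, b or d.\<close>

lemma faces_of_tetrahedron_at_node:
  assumes "distinct [n, a, b, d]"
  shows "{f. card f = 3 \<and> n \<in> f \<and> f \<subseteq> {n, a, b, d}} = {{n, a, b}, {n, b, d}, {n, d, a}}"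
proof -
  have "f \<in> {{n, a, b}, {n, b, d}, {n, d, a}}"
    if f: "card f = 3" "n \<in> f" "f \<subseteq> {n, a, b, d}" for f
  proof -
    have "card ({n, a, b, d} - f) = 1"
      using assms f(1) card_Diff_subset[of f "{n, a, b, d}"] finite_subset[OF f(3)] f(3) by simp
    then obtain v where v: "{n, a, b, d} - f = {v}"
      by (rule card_1_singletonE)
    then have fv: "f = {n, a, b, d} - {v}"
      using double_diff[OF f(3) subset_refl] by simp
    have "v \<in> {n, a, b, d} - f"
      unfolding v by simp
    then have "v = a \<or> v = b \<or> v = d"
      using f(2) by auto
    then show ?thesis
    proof (elim disjE)
      assume "v = a"
      then have "f = {n, b, d}" unfolding fv using assms by auto
      then show ?thesis by simp
    next
      assume "v = b"
      then have "f = {n, d, a}" unfolding fv using assms by auto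
      then show ?thesis by simp
    next
      assume "v = d"
      then have "f = {n, a, b}" unfolding fv using assms by auto
      then show ?thesis by simp
    qed
  qed
  moreover have "f \<in> {f. card f = 3 \<and> n \<in> f \<and> f \<subseteq> {n, a, b, d}}"
    if "f \<in> {{n, a, b}, {n, b, d}, {n, d, a}}" for f
    using that assms by (elim insertE emptyE) auto
  ultimately show ?thesis
    by (intro equalityI subsetI) simp_all
qed

lemma edge_vec_sign:
  assumes "n \<noteq> a" "case eo {n, a} of (x, y) \<Rightarrow> {n, a} = {x, y}"
  obtains k where "edge_vec eo {n, a} = k *\<^sub>R (a - n)" "\<bar>k\<bar> = 1"
proof -
  obtain x y where xy: "eo {n, a} = (x, y)"
    using prod.exhaust by blast
  with assms have "x = n \<and> y = a \<or> x = a \<and> y = n"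
    by (auto simp: doubleton_eq_iff)
  then have "edge_vec eo {n, a} = 1 *\<^sub>R (a - n) \<or> edge_vec eo {n, a} = (-1) *\<^sub>R (a - n)"
    by (auto simp: edge_vec_def xy)
  then show thesis
    using that[of 1] that[of "-1"] by auto
qed

text \<open>Rotating a, b, d keeps the determinant \<open>?t\<close>, so the three edges share the
  factor sgn \<open>?t\<close> / 12 and the expansion above applies; |\<open>?t\<close>| is six
  times the volume. The factor 1/2 in \<open>edge_matrix\<close> turns the half into the quarter of
  the cell that lies in the dual cell.\<close>

lemma sum_edge_cell_contributions:
  assumes c: "card c = 4" "\<not> affine_dependent c" "n \<in> c"
    and eo: "\<And>e. card e = 2 \<Longrightarrow> e \<subseteq> c \<Longrightarrow> case eo e of (x, y) \<Rightarrow> e = {x, y}"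
  shows "(\<Sum>e | card e = 2 \<and> n \<in> e \<and> e \<subseteq> c.
      ((dual_face_part eo e c + s_part eo n e c) \<bullet> u) *\<^sub>R edge_vec eo e) =
    (measure lebesgue (convex hull c) / 2) *\<^sub>R u"
proof -
  obtain a b d where abd: "c = {n, a, b, d}" "distinct [n, a, b, d]"
    using card_4_containing[OF c(1,3)] .
  have *: "((dual_face_part eo {n, x} c + s_part eo n {n, x} c) \<bullet> u) *\<^sub>R edge_vec eo {n, x} =
      (sgn (cross3 (x - n) (y - n) \<bullet> (z - n)) / 12 * (cross3 (y - n) (z - n) \<bullet> u)) *\<^sub>R (x - n)"
    if xyz: "{n, x, y, z} = c" "distinct [n, x, y, z]" for x y z
  proof -
    obtain k where "edge_vec eo {n, x} = k *\<^sub>R (x - n)" "\<bar>k\<bar> = 1"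
    proof (rule edge_vec_sign[of n x eo])
      show "n \<noteq> x" using xyz(2) by simp
      show "case eo {n, x} of (y, z) \<Rightarrow> {n, x} = {y, z}"
        using xyz by (intro eo) auto
    qed
    with edge_cell_contribution[OF xyz(2) _ this] c(2) show ?thesis
      unfolding xyz(1) by simp
  qed
  have rot: "{n, b, d, a} = c" "distinct [n, b, d, a]" "{n, d, a, b} = c" "distinct [n, d, a, b]"
    using abd by auto
  let ?t = "cross3 (a - n) (b - n) \<bullet> (d - n)"
  have t: "cross3 (b - n) (d - n) \<bullet> (a - n) = ?t" "cross3 (d - n) (a - n) \<bullet> (b - n) = ?t"
    by (metis triple_product_cyclic)+
  have ne: "{n, a} \<noteq> {n, b}" "{n, b} \<noteq> {n, d}" "{n, a} \<noteq> {n, d}"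
    using abd(2) by (auto simp: doubleton_eq_iff)
  have "(\<Sum>e | card e = 2 \<and> n \<in> e \<and> e \<subseteq> c.
      ((dual_face_part eo e c + s_part eo n e c) \<bullet> u) *\<^sub>R edge_vec eo e) =
    (\<Sum>e \<in> {{n, a}, {n, b}, {n, d}}.
      ((dual_face_part eo e c + s_part eo n e c) \<bullet> u) *\<^sub>R edge_vec eo e)"
    unfolding abd(1) edges_of_tetrahedron_at_node[OF abd(2)] ..
  also have "\<dots> =
    (sgn ?t / 12 * (cross3 (b - n) (d - n) \<bullet> u)) *\<^sub>R (a - n) +
    (sgn ?t / 12 * (cross3 (d - n) (a - n) \<bullet> u)) *\<^sub>R (b - n) +
    (sgn ?t / 12 * (cross3 (a - n) (b - n) \<bullet> u)) *\<^sub>R (d - n)"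
    using *[OF abd(1)[symmetric] abd(2)] *[OF rot(1,2)] *[OF rot(3,4)] ne by (simp add: t)
  also have "\<dots> = (sgn ?t / 12) *\<^sub>R (?t *\<^sub>R u)"
    unfolding triple_product_expansion[of "b - n" "d - n" u "a - n", symmetric]
    by (simp add: scaleR_add_right)
  also have "\<dots> = (measure lebesgue (convex hull c) / 2) *\<^sub>R u"
    by (simp add: abd(1) content_convex_hull_4 abs_sgn)
  finally show ?thesis .
qed

text \<open>The same rotation argument with the dual expansion and the factor 1/8. The factor 1/3 in
  \<open>face_matrix\<close> again leaves a quarter of the cell.\<close>

lemma sum_face_cell_contributions:
  assumes c: "card c = 4" "\<not> affine_dependent c" "n \<in> c"
    and fo: "\<And>f. card f = 3 \<Longrightarrow> f \<subseteq> c \<Longrightarrow> case fo f of (x, y, z) \<Rightarrow> f = {x, y, z}"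
  shows "(\<Sum>f | card f = 3 \<and> n \<in> f \<and> f \<subseteq> c.
      ((dual_edge_part fo f c + l_part fo n f c) \<bullet> u) *\<^sub>R face_vec fo f) =
    (3 * measure lebesgue (convex hull c) / 4) *\<^sub>R u"
proof -
  obtain a b d where abd: "c = {n, a, b, d}" "distinct [n, a, b, d]"
    using card_4_containing[OF c(1,3)] .
  have *: "((dual_edge_part fo {n, x, y} c + l_part fo n {n, x, y} c) \<bullet> u) *\<^sub>R face_vec fo {n, x, y} =
      (sgn (cross3 (x - n) (y - n) \<bullet> (z - n)) / 8 * ((z - n) \<bullet> u)) *\<^sub>R cross3 (x - n) (y - n)"
    if xyz: "{n, x, y, z} = c" "distinct [n, x, y, z]" for x y z
    using face_cell_contribution[of n x y z fo u] fo[of "{n, x, y}"] c(2) xyz by auto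
  have rot: "{n, b, d, a} = c" "distinct [n, b, d, a]" "{n, d, a, b} = c" "distinct [n, d, a, b]"
    using abd by auto
  let ?t = "cross3 (a - n) (b - n) \<bullet> (d - n)"
  have t: "cross3 (b - n) (d - n) \<bullet> (a - n) = ?t" "cross3 (d - n) (a - n) \<bullet> (b - n) = ?t"
    by (metis triple_product_cyclic)+
  have ne: "{n, a, b} \<noteq> {n, b, d}" "{n, b, d} \<noteq> {n, d, a}" "{n, a, b} \<noteq> {n, d, a}"
    using abd(2) by auto
  have "(\<Sum>f | card f = 3 \<and> n \<in> f \<and> f \<subseteq> c.
      ((dual_edge_part fo f c + l_part fo n f c) \<bullet> u) *\<^sub>R face_vec fo f) =
    (\<Sum>f \<in> {{n, a, b}, {n, b, d}, {n, d, a}}.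
      ((dual_edge_part fo f c + l_part fo n f c) \<bullet> u) *\<^sub>R face_vec fo f)"
    unfolding abd(1) faces_of_tetrahedron_at_node[OF abd(2)] ..
  also have "\<dots> =
    (sgn ?t / 8 * ((a - n) \<bullet> u)) *\<^sub>R cross3 (b - n) (d - n) +
    (sgn ?t / 8 * ((b - n) \<bullet> u)) *\<^sub>R cross3 (d - n) (a - n) +
    (sgn ?t / 8 * ((d - n) \<bullet> u)) *\<^sub>R cross3 (a - n) (b - n)"
    using *[OF abd(1)[symmetric] abd(2)] *[OF rot(1,2)] *[OF rot(3,4)] ne by (simp add: t)
  also have "\<dots> = (sgn ?t / 8) *\<^sub>R (?t *\<^sub>R u)"
    unfolding triple_product_dual_expansion[of "a - n" u "b - n" "d - n", symmetric]
    by (simp add: scaleR_add_right)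
  also have "\<dots> = (3 * measure lebesgue (convex hull c) / 4) *\<^sub>R u"
    by (simp add: abd(1) content_convex_hull_4 abs_sgn)
  finally show ?thesis .
qed

section \<open>Volume of the dual cell\<close>

text \<open>Provides barycentric coordinates, and differences of them, as affine functions on the
  whole space. Moving one vertex to the origin makes the others linearly independent, so a linear
  functional can be prescribed on them.\<close>

lemma affine_extension_of_independent:
  fixes c :: "point set" and h :: "point \<Rightarrow> real"
  assumes "\<not> affine_dependent c"
  obtains g \<beta> where "\<And>x. x \<in> c \<Longrightarrow> g \<bullet> x + \<beta> = h x"
proof (cases "c = {}")
  case True
  then show ?thesis using that by blast
next
  case False
  then obtain v where v: "v \<in> c" by blast
  define B where "B = (\<lambda>x. - v + x) ` (c - {v})"
  have "independent B"
    unfolding B_def using v assms affine_dependent_iff_dependent2 by blast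
  then obtain l :: "point \<Rightarrow> real" where l: "linear l"
      "\<And>x. x \<in> B \<Longrightarrow> l x = h (x + v) - h v"
    using linear_independent_extend[of B "\<lambda>x. h (x + v) - h v"] by blast
  show ?thesis
  proof (rule that)
    fix x assume x: "x \<in> c"
    \<comment> \<open>The adjoint applied to 1 is the vector that represents \<open>l\<close> as an
      inner product.\<close>
    have "adjoint l 1 \<bullet> y = l y" for y
      using adjoint_works[OF l(1), of y 1] by (simp add: inner_commute)
    moreover have "l (x - v) = h x - h v"
      using l(2)[of "- v + x"] linear_0[OF l(1)] x by (cases "x = v") (auto simp: B_def)
    ultimately show "adjoint l 1 \<bullet> x + (h v - l v) = h x"
      using linear_diff[OF l(1)] by simp
  qed
qed

lemma affine_at_barycenter:
  assumes "\<And>x. x \<in> s \<Longrightarrow> g \<bullet> x + \<beta> = h x" "card s > 0"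
  shows "g \<bullet> barycenter s + \<beta> = (\<Sum>x\<in>s. h x) / card s"
proof -
  have "(\<Sum>x\<in>s. h x) = g \<bullet> (\<Sum>x\<in>s. x) + card s * \<beta>"
    using assms(1) by (simp add: inner_sum_right sum.distrib flip: assms(1))
  then show ?thesis
    using assms(2) by (simp add: barycenter_def field_simps)
qed

text \<open>Indexing the pieces by flags turns the union in \<open>dual_cell_part\<close> into an
  indexed one, whose measure is a sum over the index set.\<close>

definition flags :: "point \<Rightarrow> point set \<Rightarrow> (point set \<times> point set) set" where
  "flags n c = {(e, f). card e = 2 \<and> card f = 3 \<and> n \<in> e \<and> e \<subseteq> f \<and> f \<subseteq> c}"

definition flag_simplex :: "point \<Rightarrow> point set \<Rightarrow> point set \<times> point set \<Rightarrow> point set" where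
  "flag_simplex n c p = convex hull {n, barycenter (fst p), barycenter (snd p), barycenter c}"

lemma dual_cell_part_flags: "dual_cell_part n c = (\<Union>p\<in>flags n c. flag_simplex n c p)"
  unfolding dual_cell_part_def flags_def flag_simplex_def by fastforce

lemma finite_flags: "finite c \<Longrightarrow> finite (flags n c)"
  by (rule finite_subset[of _ "Pow c \<times> Pow c"]) (auto simp: flags_def)

text \<open>There are three edges at n and two faces of the cell through each of them.\<close>

lemma card_flags:
  assumes "card c = 4" "n \<in> c"
  shows "card (flags n c) = 6"
proof -
  obtain a b d where abd: "c = {n, a, b, d}" "distinct [n, a, b, d]"
    using card_4_containing[OF assms] .
  have eq: "flags n c = (SIGMA e:{e. card e = 2 \<and> n \<in> e \<and> e \<subseteq> c}. {f. card f = 3 \<and> e \<subseteq> f \<and> f \<subseteq> c})"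
    by (auto simp: flags_def)
  have two: "card {f. card f = 3 \<and> {n, x} \<subseteq> f \<and> f \<subseteq> c} = 2"
    if "{n, x, y, z} = c" "distinct [n, x, y, z]" for x y z
  proof -
    have "{n, x, y} \<noteq> {n, x, z}" using that(2) by auto
    then show ?thesis
      unfolding that(1)[symmetric] faces_of_tetrahedron_containing_edge[OF that(2)] by simp
  qed
  have rot: "{n, b, d, a} = c" "distinct [n, b, d, a]" "{n, d, a, b} = c" "distinct [n, d, a, b]"
    using abd by auto
  have ne: "{n, a} \<noteq> {n, b}" "{n, b} \<noteq> {n, d}" "{n, a} \<noteq> {n, d}"
    using abd(2) by (auto simp: doubleton_eq_iff)
  have edges: "{e. card e = 2 \<and> n \<in> e \<and> e \<subseteq> c} = {{n, a}, {n, b}, {n, d}}"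
    unfolding abd(1) by (rule edges_of_tetrahedron_at_node[OF abd(2)])
  have "finite c" using abd by simp
  then have "card (flags n c) =
      (\<Sum>e\<in>{{n, a}, {n, b}, {n, d}}. card {f. card f = 3 \<and> e \<subseteq> f \<and> f \<subseteq> c})"
    unfolding eq edges by (intro card_SigmaI) auto
  also have "\<dots> = (\<Sum>e\<in>{{n, a}, {n, b}, {n, d}}. 2)"
    using two[OF abd(1)[symmetric] abd(2)] two[OF rot(1,2)] two[OF rot(3,4)] by (intro sum.cong) auto
  also have "\<dots> = 6"
    using ne by simp
  finally show ?thesis .
qed

text \<open>Let a, b, d be the vertices added one after the other along the flag. In terms of a - n,
  b - n, d - n the edges of the piece form a triangular matrix with diagonal 1/2, 1/3, 1/4, of
  determinant 1/24.\<close>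

lemma measure_flag_simplex:
  assumes c: "card c = 4" and p: "p \<in> flags n c"
  shows "measure lebesgue (flag_simplex n c p) = measure lebesgue (convex hull c) / 24"
proof -
  obtain e f where ef: "p = (e, f)" "card e = 2" "card f = 3" "n \<in> e" "e \<subseteq> f" "f \<subseteq> c"
    using p by (auto simp: flags_def)
  obtain a where a: "e = {n, a}" "a \<noteq> n"
    using ef(2,4) by (auto simp: card_2_iff)
  have "finite f" "finite c"
    using ef c by (auto intro: card_ge_0_finite)
  then have "card (f - e) = 1" "card (c - f) = 1"
    using ef c by (simp_all add: card_Diff_subset finite_subset)
  then obtain b d where bd: "f - e = {b}" "c - f = {d}"
    by (metis card_1_singletonE)
  have f: "f = {n, a, b}" and c': "c = {n, a, b, d}"
    using bd ef(5,6) a by auto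
  have dist: "distinct [n, a, b, d]"
    using bd a f by auto
  have 1: "barycenter e - n = (1/2) *\<^sub>R (a - n)"
    unfolding a(1) barycenter_pair[OF a(2)[symmetric]] by (simp add: vec_eq_iff field_simps)
  have 2: "barycenter f - n = (1/3) *\<^sub>R (a - n) + (1/3) *\<^sub>R (b - n)"
    using f dist by (simp add: barycenter_triple vec_eq_iff field_simps)
  have 3: "barycenter c - n = (1/4) *\<^sub>R (a - n) + (1/4) *\<^sub>R (b - n) + (1/4) *\<^sub>R (d - n)"
    using c' dist by (simp add: barycenter_quadruple vec_eq_iff field_simps)
  have *: "cross3 ((1/2) *\<^sub>R A) ((1/3) *\<^sub>R A + (1/3) *\<^sub>R B) \<bullet> ((1/4) *\<^sub>R A + (1/4) *\<^sub>R B + (1/4) *\<^sub>R D) =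
    (cross3 A B \<bullet> D) / 24" for A B D :: point
    by (simp add: cross_mult_left cross_mult_right cross_add_right inner_add_right dot_cross_self)
  have "cross3 (barycenter e - n) (barycenter f - n) \<bullet> (barycenter c - n) =
      (cross3 (a - n) (b - n) \<bullet> (d - n)) / 24"
    unfolding 1 2 3 by (rule *)
  then show ?thesis
    by (simp add: flag_simplex_def ef(1) content_convex_hull_4) (simp add: c' content_convex_hull_4)
qed

lemma flag_simplex_lmeasurable: "flag_simplex n c p \<in> lmeasurable"
  by (simp add: flag_simplex_def lmeasurable_compact finite_imp_compact compact_convex_hull)

text \<open>\<open>g \<bullet> z + \<beta>\<close> is the difference of the barycentric coordinates of \<open>z\<close> at \<open>x\<close> and at \<open>y\<close>.\<close>

lemma flag_simplex_coordinates:
  assumes c: "\<not> affine_dependent c" and p: "p \<in> flags n c" and s: "s = fst p \<or> s = snd p"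
    and pq: "x \<in> s" "y \<in> c - s"
    and g: "\<And>z. z \<in> c \<Longrightarrow> g \<bullet> z + \<beta> = (if z = x then 1 else if z = y then -1 else 0)"
  shows "flag_simplex n c p \<subseteq> {z. g \<bullet> z \<ge> - \<beta>}"
proof -
  obtain e f where ef: "p = (e, f)" "card e = 2" "card f = 3" "n \<in> e" "e \<subseteq> f" "f \<subseteq> c"
    using p by (auto simp: flags_def)
  have fin: "finite c" using c aff_independent_finite by blast
  \<comment> \<open>The vertices of the piece are the barycenters of the members t of the chain {n},
    e, f, c, all comparable with s. If t contains y, it is not inside s, hence contains s and with
    it x, and the values 1 and -1 cancel.\<close>
  have "g \<bullet> barycenter t \<ge> - \<beta>" if t: "t \<subseteq> c" "t \<subseteq> s \<or> s \<subseteq> t" "t \<noteq> {}" for t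
  proof -
    have ft: "finite t" using fin t finite_subset by blast
    have "(\<Sum>z\<in>t. if z = x then 1 else if z = y then -1 else 0 :: real) \<ge> 0"
    proof (cases "y \<in> t")
      case True
      then have xt: "x \<in> t" "x \<noteq> y" using t pq by auto
      have "(\<Sum>z\<in>t. if z = x then 1 else if z = y then -1 else 0 :: real) =
          (\<Sum>z\<in>t. (if z = x then 1 else 0) + (if z = y then -1 else 0))"
        using xt by (intro sum.cong) auto
      also have "\<dots> = 0"
        using ft xt True by (simp add: sum.distrib)
      finally show ?thesis by simp
    next
      case False
      then show ?thesis by (intro sum_nonneg) auto
    qed
    moreover have "g \<bullet> barycenter t + \<beta> = (\<Sum>z\<in>t. if z = x then 1 else if z = y then -1 else 0) / card t"
      using t ft g by (intro affine_at_barycenter) (auto simp: card_gt_0_iff)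
    ultimately have "g \<bullet> barycenter t + \<beta> \<ge> 0" by simp
    then show ?thesis by simp
  qed
  moreover have "barycenter {n} = n" by (simp add: barycenter_def)
  moreover have "{n} \<subseteq> c" "e \<noteq> {}" "f \<noteq> {}" "c \<noteq> {}" "e \<subseteq> c" "s \<subseteq> c" "{n} \<subseteq> s"
    using ef s by auto
  ultimately have "{n, barycenter e, barycenter f, barycenter c} \<subseteq> {z. g \<bullet> z \<ge> - \<beta>}"
    using ef s
    by (metis (no_types, lifting) empty_subsetI fst_conv snd_conv insert_not_empty insert_subset
        mem_Collect_eq order_refl)
  then show ?thesis
    unfolding flag_simplex_def ef(1) fst_conv snd_conv
    by (rule hull_minimal) (rule convex_halfspace_ge)
qed

text \<open>Distinct flags differ in their edges or in their faces, say s and t. These have equal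
  size, so there are x in s - t and y in t - s. The coordinate at x minus the one at y is
  nonnegative on one piece and nonpositive on the other, so the pieces meet within a plane.\<close>

lemma negligible_flag_simplex_Int:
  assumes c: "\<not> affine_dependent c" and p: "p \<in> flags n c" and q: "q \<in> flags n c" and "p \<noteq> q"
  shows "negligible (flag_simplex n c p \<inter> flag_simplex n c q)"
proof -
  have fin: "finite c" using c aff_independent_finite by blast
  have *: ?thesis if st: "s = fst p \<and> t = fst q \<or> s = snd p \<and> t = snd q" and "s \<noteq> t" for s t
  proof -
    have sc: "s \<subseteq> c" "t \<subseteq> c" "card s = card t"
      using st p q by (auto simp: flags_def)
    then have "\<not> s \<subseteq> t" "\<not> t \<subseteq> s"
      using \<open>s \<noteq> t\<close> fin by (metis card_subset_eq finite_subset)+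
    then obtain x y where xy: "x \<in> s" "x \<notin> t" "y \<in> t" "y \<notin> s" by blast
    obtain g \<beta> where g: "\<And>z. z \<in> c \<Longrightarrow> g \<bullet> z + \<beta> = (if z = x then 1 else if z = y then -1 else 0)"
      using affine_extension_of_independent[OF c, of "\<lambda>z. if z = x then 1 else if z = y then -1 else 0"]
      by blast
    have "flag_simplex n c p \<subseteq> {z. g \<bullet> z \<ge> - \<beta>}"
      by (rule flag_simplex_coordinates[OF c p _ _ _ g]) (use st xy sc in auto)
    moreover have "flag_simplex n c q \<subseteq> {z. (- g) \<bullet> z \<ge> - (- \<beta>)}"
    proof (rule flag_simplex_coordinates[OF c q])
      show "t = fst q \<or> t = snd q" using st by auto
      show "y \<in> t" "x \<in> c - t" using xy sc by auto
      fix z assume "z \<in> c"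
      then show "- g \<bullet> z + - \<beta> = (if z = y then 1 else if z = x then -1 else 0)"
        using g[of z] xy by (auto split: if_splits)
    qed
    ultimately have "flag_simplex n c p \<inter> flag_simplex n c q \<subseteq>
        {z. g \<bullet> z \<ge> - \<beta>} \<inter> {z. (- g) \<bullet> z \<ge> - (- \<beta>)}"
      by (rule Int_mono)
    also have "\<dots> \<subseteq> {z. g \<bullet> z = - \<beta>}"
      by auto
    finally have "flag_simplex n c p \<inter> flag_simplex n c q \<subseteq> {z. g \<bullet> z = - \<beta>}" .
    moreover have "g \<noteq> 0"
    proof -
      have "x \<in> c" "y \<in> c" "x \<noteq> y" using xy sc by auto
      then show ?thesis using g[of x] g[of y] by auto
    qed
    ultimately show ?thesis
      by (metis negligible_hyperplane negligible_subset)
  qed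
  show ?thesis
  proof (cases "fst p = fst q")
    case True
    with \<open>p \<noteq> q\<close> have "snd p \<noteq> snd q" by (auto simp: prod_eq_iff)
    then show ?thesis using * by blast
  next
    case False
    then show ?thesis using * by blast
  qed
qed

lemma measure_dual_cell_part:
  assumes c: "card c = 4" "\<not> affine_dependent c" "n \<in> c"
  shows "measure lebesgue (dual_cell_part n c) = measure lebesgue (convex hull c) / 4"
proof -
  have fin: "finite c" using c aff_independent_finite by blast
  have "measure lebesgue (dual_cell_part n c) = (\<Sum>p\<in>flags n c. measure lebesgue (flag_simplex n c p))"
    unfolding dual_cell_part_flags
    by (rule measure_negligible_finite_Union_image)
       (use fin c in \<open>auto simp: finite_flags flag_simplex_lmeasurable pairwise_def negligible_flag_simplex_Int\<close>)
  also have "\<dots> = measure lebesgue (convex hull c) / 4"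
    by (simp add: measure_flag_simplex[OF c(1)] card_flags[OF c(1,3)])
  finally show ?thesis .
qed

lemma dual_cell_part_lmeasurable: "finite c \<Longrightarrow> dual_cell_part n c \<in> lmeasurable"
  unfolding dual_cell_part_flags
  by (intro fmeasurable.finite_UN) (auto simp: finite_flags flag_simplex_lmeasurable)

lemma barycenter_in_convex_hull:
  assumes "finite s" "s \<noteq> {}"
  shows "barycenter s \<in> convex hull s"
  unfolding barycenter_def convex_hull_finite[OF assms(1)]
  using assms by (auto intro!: exI[of _ "\<lambda>_. 1 / real (card s)"] simp: scaleR_sum_right)

lemma dual_cell_part_subset:
  assumes "finite c"
  shows "dual_cell_part n c \<subseteq> convex hull c"
proof -
  have "flag_simplex n c p \<subseteq> convex hull c" if p: "p \<in> flags n c" for p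
  proof -
    obtain e f where ef: "p = (e, f)" "card e = 2" "card f = 3" "n \<in> e" "e \<subseteq> f" "f \<subseteq> c"
      using p by (auto simp: flags_def)
    have "barycenter t \<in> convex hull c" if "t \<subseteq> c" "t \<noteq> {}" for t
      using barycenter_in_convex_hull[OF finite_subset[OF that(1) assms] that(2)] hull_mono[OF that(1)]
      by (rule rev_subsetD)
    moreover have "n \<in> convex hull c"
      using ef by (auto intro: hull_inc)
    ultimately show ?thesis
      unfolding flag_simplex_def using ef
      by (intro hull_minimal convex_convex_hull) (simp, intro conjI, auto)
  qed
  then show ?thesis
    unfolding dual_cell_part_flags by blast
qed

text \<open>The barycenter of s has a positive coordinate at each vertex of s, whereas every point
  of the hull of t has coordinate 0 at the vertices outside t. This is how a cell is recognized as
  containing a face.\<close>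

lemma subset_if_barycenter_in_convex_hull:
  assumes c: "\<not> affine_dependent c" and st: "s \<subseteq> c" "t \<subseteq> c" and bary: "barycenter s \<in> convex hull t"
  shows "s \<subseteq> t"
proof
  fix p assume p: "p \<in> s"
  show "p \<in> t"
  proof (rule ccontr)
    assume "p \<notin> t"
    have fin: "finite s" using c st aff_independent_finite finite_subset by blast
    obtain g \<beta> where g: "\<And>z. z \<in> c \<Longrightarrow> g \<bullet> z + \<beta> = (if z = p then 1 else 0)"
      using affine_extension_of_independent[OF c, of "\<lambda>z. if z = p then 1 else 0"] by blast
    have "t \<subseteq> {z. g \<bullet> z = - \<beta>}"
    proof
      fix z assume "z \<in> t"
      with \<open>p \<notin> t\<close> st have "g \<bullet> z + \<beta> = 0" using g[of z] by auto
      then show "z \<in> {z. g \<bullet> z = - \<beta>}" by simp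
    qed
    then have "convex hull t \<subseteq> {z. g \<bullet> z = - \<beta>}"
      by (rule hull_minimal) (rule convex_hyperplane)
    moreover have "g \<bullet> barycenter s + \<beta> = (\<Sum>z\<in>s. if z = p then 1 else 0) / card s"
      using st g fin p by (intro affine_at_barycenter) (auto simp: card_gt_0_iff)
    moreover have "card s > 0" using fin p by (auto simp: card_gt_0_iff)
    ultimately show False
      using bary fin p by auto
  qed
qed

section \<open>Overlaps of cells in a conforming grid\<close>

lemma
  assumes "tetrahedral_grid \<Omega> C"
  shows finite_cells: "finite C"
    and card_cell: "c \<in> C \<Longrightarrow> card c = 4"
    and independent_cell: "c \<in> C \<Longrightarrow> \<not> affine_dependent c"
    and finite_cell: "c \<in> C \<Longrightarrow> finite c"
    and closure_grid: "closure \<Omega> = (\<Union>c\<in>C. convex hull c)"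
  using assms by (auto simp: tetrahedral_grid_def intro: card_ge_0_finite)

text \<open>Conformity makes the intersection a face of both simplices, hence the hull of a subset
  of each vertex set. The two subsets agree, both being the set of extreme points of the
  intersection.\<close>

lemma convex_hull_cell_Int:
  assumes grid: "tetrahedral_grid \<Omega> C" and c: "c \<in> C" "c' \<in> C"
  shows "convex hull c \<inter> convex hull c' = convex hull (c \<inter> c')"
proof -
  let ?I = "convex hull c \<inter> convex hull c'"
  have "?I face_of convex hull c" "convex hull c' \<inter> convex hull c face_of convex hull c'"
    using grid c by (auto simp: tetrahedral_grid_def triangulation_def)
  then obtain s s' where s: "s \<subseteq> c" "?I = convex hull s" "s' \<subseteq> c'" "?I = convex hull s'"
    using independent_cell[OF grid] c by (auto simp: face_of_convex_hull_affine_independent Int_commute)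
  have ind: "\<not> affine_dependent s" "\<not> affine_dependent s'"
    using s independent_cell[OF grid] c affine_independent_subset by blast+
  have "s = s'"
    using extreme_point_of_convex_hull_affine_independent[OF ind(1)]
      extreme_point_of_convex_hull_affine_independent[OF ind(2)] s(2,4) by auto
  then have "?I \<subseteq> convex hull (c \<inter> c')"
    using s by (simp add: hull_mono)
  moreover have "convex hull (c \<inter> c') \<subseteq> ?I"
    by (simp add: hull_mono)
  ultimately show ?thesis by blast
qed

lemma negligible_convex_hull_card_3:
  fixes s :: "point set"
  assumes "finite s" "card s \<le> 3"
  shows "negligible (convex hull s)"
proof -
  have "aff_dim s \<le> int (card s) - 1"
    using assms(1) by (rule aff_dim_le_card)
  then have "aff_dim (convex hull s) < int DIM(point)"
    using assms(2) by (simp add: aff_dim_convex_hull)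
  then have "interior (convex hull s) = {}"
    by (simp add: low_dim_interior)
  then show ?thesis
    by (simp add: negligible_convex_interior)
qed

text \<open>Distinct cells share at most three vertices, so they overlap in a set of dimension at
  most two.\<close>

lemma negligible_cell_Int:
  assumes grid: "tetrahedral_grid \<Omega> C" and c: "c \<in> C" "c' \<in> C" "c \<noteq> c'"
  shows "negligible (convex hull c \<inter> convex hull c')"
proof -
  have "c \<inter> c' \<subset> c"
    using c finite_cell[OF grid] card_cell[OF grid] by (metis Int_lower1 inf.absorb_iff1 card_subset_eq psubsetI)
  then have "card (c \<inter> c') < 4"
    using psubset_card_mono[OF finite_cell[OF grid c(1)]] card_cell[OF grid c(1)] by simp
  then show ?thesis
    unfolding convex_hull_cell_Int[OF grid c(1,2)]
    using finite_cell[OF grid c(1)] by (intro negligible_convex_hull_card_3) auto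
qed

lemma measure_dual_cell:
  assumes grid: "tetrahedral_grid \<Omega> C"
  shows "measure lebesgue (dual_cell C n) = (\<Sum>c\<in>cells_at C {n}. measure lebesgue (convex hull c) / 4)"
proof -
  have sub: "c \<in> C" "n \<in> c" if "c \<in> cells_at C {n}" for c
    using that by (auto simp: cells_at_def)
  have "measure lebesgue (dual_cell C n) = (\<Sum>c\<in>cells_at C {n}. measure lebesgue (dual_cell_part n c))"
    unfolding dual_cell_def
  proof (rule measure_negligible_finite_Union_image)
    show "finite (cells_at C {n})"
      using finite_cells[OF grid] by (simp add: cells_at_def)
    show "dual_cell_part n c \<in> lmeasurable" if "c \<in> cells_at C {n}" for c
      using sub[OF that] finite_cell[OF grid] by (simp add: dual_cell_part_lmeasurable)
    show "pairwise (\<lambda>c c'. negligible (dual_cell_part n c \<inter> dual_cell_part n c')) (cells_at C {n})"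
    proof (rule pairwiseI)
      fix c c' assume c: "c \<in> cells_at C {n}" "c' \<in> cells_at C {n}" "c \<noteq> c'"
      then have "negligible (convex hull c \<inter> convex hull c')"
        by (intro negligible_cell_Int[OF grid] sub(1))
      then show "negligible (dual_cell_part n c \<inter> dual_cell_part n c')"
        by (rule negligible_subset)
          (intro Int_mono dual_cell_part_subset finite_cell[OF grid] sub c)
    qed
  qed
  also have "\<dots> = (\<Sum>c\<in>cells_at C {n}. measure lebesgue (convex hull c) / 4)"
    by (intro sum.cong refl measure_dual_cell_part card_cell[OF grid] independent_cell[OF grid] sub)
  finally show ?thesis .
qed

section \<open>The two cells at an interior face\<close>

text \<open>Allows the side of the face to be tested with the opposite vertex d instead of the
  barycenter of the cell.\<close>

lemma barycenter_insert_cell: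
  assumes "card f = 3" "d \<notin> f"
  shows "barycenter (insert d f) - barycenter f = (1/4) *\<^sub>R (d - barycenter f)"
proof -
  have "finite f" using assms by (auto intro: card_ge_0_finite)
  moreover have "(\<Sum>x\<in>f. x) = 3 *\<^sub>R barycenter f"
    using assms by (simp add: barycenter_def)
  ultimately have "barycenter (insert d f) = (1/4) *\<^sub>R (d + 3 *\<^sub>R barycenter f)"
    using assms by (simp add: barycenter_def[of "insert d f"])
  then show ?thesis
    by (simp add: vec_eq_iff field_simps)
qed

lemma inner_normal_barycenter:
  assumes "card f = 3" "\<And>x y. x \<in> f \<Longrightarrow> y \<in> f \<Longrightarrow> N \<bullet> (x - y) = 0" "x \<in> f"
  shows "N \<bullet> (x - barycenter f) = 0"
proof -
  have "N \<bullet> y = N \<bullet> x" if "y \<in> f" for y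
    using assms(2)[OF that assms(3)] by (simp add: inner_diff_right)
  then have "(\<Sum>y\<in>f. N \<bullet> y) = 3 * (N \<bullet> x)"
    using assms(1) by simp
  then show ?thesis
    by (simp add: barycenter_def assms(1) inner_diff_right inner_sum_right)
qed

lemma cell_containing_face:
  assumes "tetrahedral_grid \<Omega> C" "card f = 3" "c \<in> cells_at C f"
  obtains d where "c = insert d f" "d \<notin> f"
proof -
  have c: "c \<in> C" "f \<subseteq> c" using assms by (auto simp: cells_at_def)
  then have "card (c - f) = 1"
    using assms(2) card_cell[OF assms(1) c(1)] finite_cell[OF assms(1) c(1)]
    by (simp add: card_Diff_subset finite_subset)
  then obtain d where "c - f = {d}" by (metis card_1_singletonE)
  then show ?thesis using c by (intro that[of d]) auto
qed

text \<open>Otherwise the whole cell would lie in the plane of the face and have volume 0.\<close>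

lemma cell_not_in_face_plane:
  assumes grid: "tetrahedral_grid \<Omega> C" and f: "card f = 3" "c \<in> cells_at C f"
    and N: "N \<noteq> 0" "\<And>x y. x \<in> f \<Longrightarrow> y \<in> f \<Longrightarrow> N \<bullet> (x - y) = 0"
  shows "N \<bullet> (barycenter c - barycenter f) \<noteq> 0"
proof
  assume 0: "N \<bullet> (barycenter c - barycenter f) = 0"
  obtain d where d: "c = insert d f" "d \<notin> f"
    using cell_containing_face[OF grid f] .
  have c: "c \<in> C" using f by (auto simp: cells_at_def)
  have "N \<bullet> (d - barycenter f) = 0"
    using 0 barycenter_insert_cell[OF f(1) d(2)] d(1) by simp
  then have "c \<subseteq> {x. N \<bullet> x = N \<bullet> barycenter f}"
    using inner_normal_barycenter[OF f(1) N(2)] d(1) by (auto simp: inner_diff_right)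
  then have "convex hull c \<subseteq> {x. N \<bullet> x = N \<bullet> barycenter f}"
    by (rule hull_minimal) (rule convex_hyperplane)
  then have "negligible (convex hull c)"
    using N(1) negligible_hyperplane negligible_subset by blast
  then show False
    using measure_simplex_pos[OF card_cell[OF grid c] independent_cell[OF grid c]]
    by (simp add: negligible_imp_measure0)
qed

text \<open>A point slightly displaced from the barycenter along N still lies in the region, but in
  no cell that misses the barycenter. So it lies in a cell that contains the barycenter and
  therefore the face. As this cell has a point on the positive side, its opposite vertex is there
  too.\<close>

lemma cell_on_side_exists:
  assumes grid: "tetrahedral_grid \<Omega> C" and f: "f \<in> grid_faces C"
    and int: "barycenter f \<in> interior (\<Union>c\<in>C. convex hull c)"
    and N: "N \<noteq> 0" "\<And>x y. x \<in> f \<Longrightarrow> y \<in> f \<Longrightarrow> N \<bullet> (x - y) = 0"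
  obtains c where "c \<in> cells_at C f" "N \<bullet> (barycenter c - barycenter f) > 0"
proof -
  obtain c0 where c0: "c0 \<in> C" "f \<subseteq> c0" and f3: "card f = 3"
    using f by (auto simp: grid_faces_def)
  let ?b = "barycenter f"
  have finf: "finite f" "f \<noteq> {}" using f3 by (auto intro: card_ge_0_finite)
  define U where "U = (\<Union>c\<in>{c\<in>C. ?b \<notin> convex hull c}. convex hull c)"
  have "closed U"
    unfolding U_def using finite_cells[OF grid] finite_cell[OF grid]
    by (intro closed_UN ballI compact_imp_closed compact_convex_hull finite_imp_compact) auto
  then have "open (interior (\<Union>c\<in>C. convex hull c) - U)"
    by (simp add: open_Diff)
  moreover have "?b \<in> interior (\<Union>c\<in>C. convex hull c) - U"
    using int by (auto simp: U_def)
  ultimately obtain r where r: "r > 0" "ball ?b r \<subseteq> interior (\<Union>c\<in>C. convex hull c) - U"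
    by (meson open_contains_ball)
  \<comment> \<open>A step of length r/2 in the direction of N.\<close>
  define x where "x = ?b + (r / (2 * norm N)) *\<^sub>R N"
  have "x \<in> ball ?b r"
    using r(1) N(1) by (simp add: x_def dist_norm)
  then have "x \<in> (\<Union>c\<in>C. convex hull c)" "x \<notin> U"
    using r(2) interior_subset by blast+
  then obtain c where c: "c \<in> C" "x \<in> convex hull c" "?b \<in> convex hull c"
    by (auto simp: U_def)
  have "?b \<in> convex hull c0"
    using barycenter_in_convex_hull[OF finf] hull_mono[OF c0(2)] by blast
  then have "?b \<in> convex hull (c0 \<inter> c)"
    using c convex_hull_cell_Int[OF grid c0(1) c(1)] by blast
  then have fc: "f \<subseteq> c"
    using subset_if_barycenter_in_convex_hull[OF independent_cell[OF grid c0(1)] c0(2), of "c0 \<inter> c"] by blast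
  then have cf: "c \<in> cells_at C f" using c by (simp add: cells_at_def)
  obtain d where d: "c = insert d f" "d \<notin> f"
    using cell_containing_face[OF grid f3 cf] .
  have "N \<bullet> (d - ?b) > 0"
  proof (rule ccontr)
    assume "\<not> N \<bullet> (d - ?b) > 0"
    then have "c \<subseteq> {y. N \<bullet> y \<le> N \<bullet> ?b}"
      using inner_normal_barycenter[OF f3 N(2)] d(1) by (auto simp: inner_diff_right)
    then have "convex hull c \<subseteq> {y. N \<bullet> y \<le> N \<bullet> ?b}"
      by (rule hull_minimal) (rule convex_halfspace_le)
    then have "N \<bullet> x \<le> N \<bullet> ?b" using c by auto
    moreover have "N \<bullet> x = N \<bullet> ?b + r / (2 * norm N) * (N \<bullet> N)"
      by (simp add: x_def inner_add_right)
    moreover have "r / (2 * norm N) * (N \<bullet> N) > 0"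
      using r(1) N(1) by (intro mult_pos_pos) auto
    ultimately show False
      by linarith
  qed
  then have "N \<bullet> (barycenter c - ?b) > 0"
    using barycenter_insert_cell[OF f3 d(2)] d(1) by simp
  with cf show thesis by (rule that)
qed

text \<open>Two such cells would meet only in the face, hence in its plane. But near the barycenter,
  which is in the relative interior of the face, each of them fills the half-space on its side: a
  short move from the barycenter towards \<open>d'\<close> stays in both.\<close>

lemma cell_on_side_unique:
  assumes grid: "tetrahedral_grid \<Omega> C" and f3: "card f = 3"
    and c: "c \<in> cells_at C f" "c' \<in> cells_at C f"
    and N: "\<And>x y. x \<in> f \<Longrightarrow> y \<in> f \<Longrightarrow> N \<bullet> (x - y) = 0"
    and pos: "N \<bullet> (barycenter c - barycenter f) > 0" "N \<bullet> (barycenter c' - barycenter f) > 0"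
  shows "c = c'"
proof (rule ccontr)
  assume ne: "c \<noteq> c'"
  let ?b = "barycenter f"
  obtain d where d: "c = insert d f" "d \<notin> f"
    using cell_containing_face[OF grid f3 c(1)] .
  obtain d' where d': "c' = insert d' f" "d' \<notin> f"
    using cell_containing_face[OF grid f3 c(2)] .
  have cC: "c \<in> C" "c' \<in> C" using c by (auto simp: cells_at_def)
  have finf: "finite f" "f \<noteq> {}" using f3 by (auto intro: card_ge_0_finite)
  have Nd: "N \<bullet> (d - ?b) > 0" "N \<bullet> (d' - ?b) > 0"
    using pos barycenter_insert_cell[OF f3 d(2)] barycenter_insert_cell[OF f3 d'(2)] d(1) d'(1) by simp_all
  have "c \<inter> c' = f"
    using d d' ne by auto
  then have Int: "convex hull c \<inter> convex hull c' = convex hull f"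
    using convex_hull_cell_Int[OF grid cC] by simp
  have "convex hull f \<subseteq> {y. N \<bullet> y = N \<bullet> ?b}"
  proof (rule hull_minimal)
    show "f \<subseteq> {y. N \<bullet> y = N \<bullet> ?b}"
      using inner_normal_barycenter[OF f3 N] by (auto simp: inner_diff_right)
  qed (rule convex_hyperplane)
  moreover have "\<exists>y \<in> convex hull c \<inter> convex hull c'. N \<bullet> y > N \<bullet> ?b"
  proof -
    have "aff_dim c = 3"
      using aff_dim_affine_independent[OF independent_cell[OF grid cC(1)]] card_cell[OF grid cC(1)] by simp
    then have "affine hull c = UNIV"
      by (simp add: aff_dim_eq_full [symmetric])
    then have "d' \<in> affine hull c" by simp
    \<comment> \<open>Affine coordinates of \<open>d'\<close> in c. Those at the vertices of f may
      be negative; the one at d is positive because d and \<open>d'\<close> lie on the same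
      side.\<close>
    then obtain u where u: "sum u c = 1" "(\<Sum>v\<in>c. u v *\<^sub>R v) = d'"
      using finite_cell[OF grid cC(1)] by (auto simp: affine_hull_finite)
    have sum_c: "sum h c = h d + sum h f" for h :: "point \<Rightarrow> 'b::comm_monoid_add"
      using d finf by simp
    have "N \<bullet> (d' - ?b) = (\<Sum>v\<in>c. u v * (N \<bullet> (v - ?b)))"
    proof -
      have "(\<Sum>v\<in>c. u v * (N \<bullet> (v - ?b))) = N \<bullet> (\<Sum>v\<in>c. u v *\<^sub>R v) - sum u c * (N \<bullet> ?b)"
        by (simp add: inner_diff_right right_diff_distrib sum_subtractf inner_sum_right sum_distrib_right)
      then show ?thesis using u by (simp add: inner_diff_right)
    qed
    also have "\<dots> = u d * (N \<bullet> (d - ?b))"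
      unfolding sum_c using inner_normal_barycenter[OF f3 N] by simp
    finally have ud: "u d > 0"
      using Nd by (simp add: zero_less_mult_iff)
    define S where "S = (\<Sum>v\<in>c. \<bar>u v\<bar>)"
    have S: "\<bar>u v\<bar> \<le> S" if "v \<in> c" for v
      unfolding S_def using that finite_cell[OF grid cC(1)] by (intro member_le_sum) auto
    have S0: "S \<ge> 0" unfolding S_def by (intro sum_nonneg) simp
    \<comment> \<open>Solves (1 - \<epsilon>)/3 = \<epsilon> * S. Since |u v| is at most S, the
      weights of the new point at the vertices of f are then nonnegative.\<close>
    define \<epsilon> where "\<epsilon> = 1 / (1 + 3 * S)"
    have \<epsilon>: "0 < \<epsilon>" "\<epsilon> \<le> 1" "\<epsilon> * (1 + 3 * S) = 1"
      using S0 by (auto simp: \<epsilon>_def)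
    define y where "y = (1 - \<epsilon>) *\<^sub>R ?b + \<epsilon> *\<^sub>R d'"
    have "?b \<in> convex hull c'" "d' \<in> convex hull c'"
      using barycenter_in_convex_hull[OF finf] hull_mono[of f c'] d' by (auto intro: hull_inc)
    then have "y \<in> convex hull c'"
      unfolding y_def using \<epsilon> by (intro convexD_alt convex_convex_hull) auto
    moreover have "y \<in> convex hull c"
    proof -
      \<comment> \<open>Coordinates of y in c: the barycenter contributes equally at the three
        vertices of f, and \<open>d'\<close> contributes through u.\<close>
      define w where "w v = (if v \<in> f then (1 - \<epsilon>) / 3 else 0) + \<epsilon> * u v" for v
      have "w v \<ge> 0" if "v \<in> c" for v
      proof (cases "v \<in> f")
        case True
        have "\<epsilon> * (1 - 3 * u v) \<le> \<epsilon> * (1 + 3 * S)"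
          using \<epsilon>(1) S[OF that] by (intro mult_left_mono) auto
        then show ?thesis using True \<epsilon>(3) by (simp add: w_def field_simps)
      next
        case False
        then have "v = d" using that d by auto
        then show ?thesis using False ud \<epsilon>(1) by (simp add: w_def)
      qed
      moreover have "sum w c = 1"
      proof -
        have "sum w c = (\<Sum>v\<in>c. if v \<in> f then (1 - \<epsilon>) / 3 else 0) + \<epsilon> * sum u c"
          by (simp add: w_def sum.distrib sum_distrib_left)
        also have "(\<Sum>v\<in>c. if v \<in> f then (1 - \<epsilon>) / 3 else 0) = 1 - \<epsilon>"
          unfolding sum_c using d f3 by simp
        finally show ?thesis using u by simp
      qed
      moreover have "(\<Sum>v\<in>c. w v *\<^sub>R v) = y"
      proof -
        have "(\<Sum>v\<in>c. w v *\<^sub>R v) =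
            (\<Sum>v\<in>c. (if v \<in> f then (1 - \<epsilon>) / 3 else 0) *\<^sub>R v) + \<epsilon> *\<^sub>R (\<Sum>v\<in>c. u v *\<^sub>R v)"
          by (simp add: w_def scaleR_add_left sum.distrib scaleR_sum_right)
        also have "(\<Sum>v\<in>c. (if v \<in> f then (1 - \<epsilon>) / 3 else 0) *\<^sub>R v) = (1 - \<epsilon>) *\<^sub>R ?b"
          unfolding sum_c using d f3 by (simp add: barycenter_def scaleR_sum_right)
        finally show ?thesis using u by (simp add: y_def)
      qed
      ultimately show ?thesis
        using finite_cell[OF grid cC(1)] by (auto simp: convex_hull_finite)
    qed
    moreover have "N \<bullet> y > N \<bullet> ?b"
    proof -
      have "N \<bullet> y = N \<bullet> ?b + \<epsilon> * (N \<bullet> (d' - ?b))"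
        by (simp add: y_def inner_add_right inner_diff_right algebra_simps)
      then show ?thesis using \<epsilon>(1) Nd(2) by simp
    qed
    ultimately show ?thesis by blast
  qed
  ultimately show False
    using Int by auto
qed

text \<open>An interior face has exactly one cell on each side, so the signs cancel.\<close>

lemma sum_sgn_side_eq_0:
  assumes grid: "tetrahedral_grid \<Omega> C" and f: "f \<in> grid_faces C"
    and int: "barycenter f \<in> interior (\<Union>c\<in>C. convex hull c)"
    and N: "\<And>x y. x \<in> f \<Longrightarrow> y \<in> f \<Longrightarrow> N \<bullet> (x - y) = 0"
  shows "(\<Sum>c\<in>cells_at C f. sgn (N \<bullet> (barycenter c - barycenter f))) = 0"
proof (cases "N = 0")
  case True
  then show ?thesis by simp
next
  case False
  let ?b = "barycenter f"
  have f3: "card f = 3" using f by (simp add: grid_faces_def)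
  have N': "(- N) \<bullet> (x - y) = 0" if "x \<in> f" "y \<in> f" for x y
    using N[OF that] by simp
  obtain c1 where c1: "c1 \<in> cells_at C f" "N \<bullet> (barycenter c1 - ?b) > 0"
    using cell_on_side_exists[OF grid f int False N] by blast
  obtain c2 where c2: "c2 \<in> cells_at C f" "(- N) \<bullet> (barycenter c2 - ?b) > 0"
    using cell_on_side_exists[OF grid f int _ N'] False by (metis neg_equal_0_iff_equal)
  have "cells_at C f = {c1, c2}"
  proof
    show "{c1, c2} \<subseteq> cells_at C f" using c1 c2 by simp
    show "cells_at C f \<subseteq> {c1, c2}"
    proof
      fix c assume c: "c \<in> cells_at C f"
      have "N \<bullet> (barycenter c - ?b) \<noteq> 0"
        by (rule cell_not_in_face_plane[OF grid f3 c False N])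
      then consider "N \<bullet> (barycenter c - ?b) > 0" | "(- N) \<bullet> (barycenter c - ?b) > 0"
        by (auto simp: neq_iff)
      then show "c \<in> {c1, c2}"
      proof cases
        case 1
        then have "c = c1" using cell_on_side_unique[OF grid f3 c c1(1) N _ c1(2)] by blast
        then show ?thesis by simp
      next
        case 2
        then have "c = c2" using cell_on_side_unique[OF grid f3 c c2(1) N' _ c2(2)] by blast
        then show ?thesis by simp
      qed
    qed
  qed
  moreover have "c1 \<noteq> c2" using c1 c2 by auto
  ultimately show ?thesis
    using c1(2) c2(2) by simp
qed

section \<open>The dual cell of an interior node\<close>

lemma barycenter_face_in_interior:
  assumes grid: "tetrahedral_grid \<Omega> C" and int: "dual_cell C n \<inter> frontier \<Omega> = {}"
    and f: "f \<in> faces_at C n"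
  shows "barycenter f \<in> interior (\<Union>c\<in>C. convex hull c)"
proof -
  obtain c where c: "c \<in> C" "f \<subseteq> c" "card f = 3" "n \<in> f"
    using f by (auto simp: faces_at_def grid_faces_def)
  have finf: "finite f" "f \<noteq> {}" using c by (auto intro: card_ge_0_finite)
  have "card (f - {n}) = 2" using c by simp
  then obtain a where a: "a \<in> f - {n}" by (metis card.empty ex_in_conv zero_neq_numeral)
  \<comment> \<open>Any edge of f at n completes f to a flag, whose piece has the barycenter of f as
    a vertex.\<close>
  have "({n, a}, f) \<in> flags n c"
    using a c by (auto simp: flags_def)
  moreover have "barycenter f \<in> flag_simplex n c ({n, a}, f)"
    by (simp add: flag_simplex_def hull_inc)
  ultimately have "barycenter f \<in> dual_cell_part n c"
    unfolding dual_cell_part_flags by blast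
  then have "barycenter f \<in> dual_cell C n"
    using c unfolding dual_cell_def cells_at_def by auto
  then have "barycenter f \<notin> frontier \<Omega>" using int by blast
  moreover have "barycenter f \<in> closure \<Omega>"
    unfolding closure_grid[OF grid]
    using barycenter_in_convex_hull[OF finf] hull_mono[OF c(2)] c(1) by blast
  ultimately have "barycenter f \<in> interior \<Omega>"
    by (simp add: frontier_def)
  then show ?thesis
    unfolding closure_grid[OF grid, symmetric] using interior_mono[OF closure_subset] by blast
qed

lemma inner_cross_triangle_eq_0:
  fixes n a b x y :: point
  assumes "N = k *\<^sub>R cross3 (a - n) (b - n)" "x \<in> {n, a, b}" "y \<in> {n, a, b}"
  shows "N \<bullet> (x - y) = 0"
proof -
  have "N \<bullet> (z - n) = 0" if "z \<in> {n, a, b}" for z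
    using that by (auto simp: assms(1) dot_cross_self)
  from this[OF assms(2)] this[OF assms(3)] show ?thesis
    by (simp add: inner_diff_right)
qed

lemma edge_vec_sign_at:
  assumes eo: "edge_orientation C eo" and e: "e \<in> edges_at C n"
  obtains a k where "e = {n, a}" "n \<noteq> a" "edge_vec eo e = k *\<^sub>R (a - n)" "\<bar>k\<bar> = 1"
proof -
  have e': "card e = 2" "n \<in> e" "e \<in> grid_edges C"
    using e by (auto simp: edges_at_def grid_edges_def)
  then obtain a where a: "e = {n, a}" "n \<noteq> a"
    by (auto simp: card_2_iff)
  obtain k where "edge_vec eo {n, a} = k *\<^sub>R (a - n)" "\<bar>k\<bar> = 1"
  proof (rule edge_vec_sign[of n a eo])
    show "case eo {n, a} of (x, y) \<Rightarrow> {n, a} = {x, y}"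
      using bspec[OF eo[unfolded edge_orientation_def] e'(3)] unfolding a(1) .
  qed (rule a(2))
  then show ?thesis using that a by blast
qed

text \<open>The sum over cells and then faces is exchanged. For a fixed face f, \<open>G f\<close>
  is common to all cells and \<open>N f\<close> is normal to f, so that the signs add up to
  0.\<close>

lemma s_vec_eq_0:
  assumes grid: "tetrahedral_grid \<Omega> C" and eo: "edge_orientation C eo"
    and int: "dual_cell C n \<inter> frontier \<Omega> = {}" and e: "e \<in> edges_at C n"
  shows "s_vec C eo n e = 0"
proof -
  obtain a k where a: "e = {n, a}" "n \<noteq> a" and k: "edge_vec eo e = k *\<^sub>R (a - n)" "\<bar>k\<bar> = 1"
    using edge_vec_sign_at[OF eo e] .
  define N where "N f = cross3 (edge_vec eo e) (barycenter f - barycenter e)" for f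
  define G where "G f = (1/2) *\<^sub>R cross3 (barycenter f - barycenter e) (edge_point n e - barycenter e)" for f
  define FF where "FF = {f \<in> grid_faces C. e \<subseteq> f}"
  have finC: "finite (cells_at C e)"
    using finite_cells[OF grid] by (simp add: cells_at_def)
  have "FF \<subseteq> (\<Union>c\<in>C. Pow c)"
    by (auto simp: FF_def grid_faces_def)
  moreover have "finite (\<Union>c\<in>C. Pow c)"
    using finite_cells[OF grid] finite_cell[OF grid] by simp
  ultimately have finF: "finite FF"
    by (rule finite_subset)
  have part: "s_part eo n e c =
      - (\<Sum>f | f \<in> FF \<and> f \<subseteq> c. sgn (N f \<bullet> (barycenter c - barycenter f)) *\<^sub>R G f)"
    if c: "c \<in> cells_at C e" for c
  proof -
    have cC: "c \<in> C" "e \<subseteq> c" using c by (auto simp: cells_at_def)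
    have "card (c - e) = 2"
      using cC card_cell[OF grid cC(1)] finite_cell[OF grid cC(1)] a
      by (simp add: card_Diff_subset finite_subset)
    then obtain b d where bd: "c - e = {b, d}" "b \<noteq> d"
      by (auto simp: card_2_iff)
    have c': "c = {n, a, b, d}" and dist: "distinct [n, a, b, d]"
      using bd cC a by auto
    have FFc: "{f. f \<in> FF \<and> f \<subseteq> c} = {f. card f = 3 \<and> e \<subseteq> f \<and> f \<subseteq> c}"
      using cC by (auto simp: FF_def grid_faces_def)
    show ?thesis
      using s_part_signed_sum[OF dist _ k(1)[unfolded a(1)] k(2)] independent_cell[OF grid cC(1)]
      unfolding FFc N_def G_def c'[symmetric] a(1)[symmetric] by blast
  qed
  have zero: "(\<Sum>c\<in>cells_at C f. sgn (N f \<bullet> (barycenter c - barycenter f))) = 0" if f: "f \<in> FF" for f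
  proof -
    have f': "f \<in> grid_faces C" "card f = 3" "e \<subseteq> f" "n \<in> f"
      using f a by (auto simp: FF_def grid_faces_def)
    then have "card (f - e) = 1"
      using a card_ge_0_finite[of f] by (simp add: card_Diff_subset)
    then obtain b where b: "f - e = {b}"
      by (rule card_1_singletonE)
    then have fb: "f = {n, a, b}" and dist: "distinct [n, a, b]"
      using f' a by auto
    have 1: "barycenter f - barycenter e = (1/3) *\<^sub>R (b - n) - (1/6) *\<^sub>R (a - n)"
      unfolding fb a(1) using dist by (simp add: barycenter_triple barycenter_pair vec_eq_iff field_simps)
    have *: "cross3 (k *\<^sub>R A) ((1/3) *\<^sub>R B - (1/6) *\<^sub>R A) = (k / 3) *\<^sub>R cross3 A B"
      for A B :: point
      by (simp add: cross_mult_left cross_mult_right Cross3.right_diff_distrib)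
    have "N f = (k / 3) *\<^sub>R cross3 (a - n) (b - n)"
      unfolding N_def 1 k(1) by (rule *)
    then have "N f \<bullet> (x - y) = 0" if "x \<in> f" "y \<in> f" for x y
      using that unfolding fb by (rule inner_cross_triangle_eq_0)
    moreover have "barycenter f \<in> interior (\<Union>c\<in>C. convex hull c)"
      using f' by (intro barycenter_face_in_interior[OF grid int]) (simp add: faces_at_def)
    ultimately show ?thesis
      using f'(1) by (intro sum_sgn_side_eq_0[OF grid]) auto
  qed
  have "s_vec C eo n e = (\<Sum>c\<in>cells_at C e. - (\<Sum>f | f \<in> FF \<and> f \<subseteq> c.
      sgn (N f \<bullet> (barycenter c - barycenter f)) *\<^sub>R G f))"
    unfolding s_vec_def by (intro sum.cong refl part)
  also have "\<dots> = - (\<Sum>c\<in>cells_at C e. \<Sum>f | f \<in> FF \<and> f \<subseteq> c.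
      sgn (N f \<bullet> (barycenter c - barycenter f)) *\<^sub>R G f)"
    by (rule sum_negf)
  also have "\<dots> = - (\<Sum>f\<in>FF. \<Sum>c | c \<in> cells_at C e \<and> f \<subseteq> c.
      sgn (N f \<bullet> (barycenter c - barycenter f)) *\<^sub>R G f)"
    by (subst sum.swap_restrict[OF finC finF]) (rule refl)
  also have "(\<Sum>f\<in>FF. \<Sum>c | c \<in> cells_at C e \<and> f \<subseteq> c.
      sgn (N f \<bullet> (barycenter c - barycenter f)) *\<^sub>R G f) = (\<Sum>f\<in>FF. 0)"
  proof (intro sum.cong refl)
    fix f assume f: "f \<in> FF"
    then have "{c. c \<in> cells_at C e \<and> f \<subseteq> c} = cells_at C f"
      by (auto simp: cells_at_def FF_def)
    then show "(\<Sum>c | c \<in> cells_at C e \<and> f \<subseteq> c.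
        sgn (N f \<bullet> (barycenter c - barycenter f)) *\<^sub>R G f) = 0"
      using zero[OF f] by (simp flip: scaleR_sum_left)
  qed
  finally show ?thesis by simp
qed

text \<open>Only one face is involved, so the contributions are one vector with varying signs. Its
  normal is the face vector itself, and \<open>nonzero\<close> allows each contribution to be
  rewritten by \<open>l_part_eq\<close>.\<close>

lemma l_vec_eq_0:
  assumes grid: "tetrahedral_grid \<Omega> C" and fo: "face_orientation C fo"
    and int: "dual_cell C n \<inter> frontier \<Omega> = {}" and f: "f \<in> faces_at C n"
  shows "l_vec C fo n f = 0"
proof -
  have f': "f \<in> grid_faces C" "card f = 3" "n \<in> f"
    using f by (auto simp: faces_at_def grid_faces_def)
  then have "card (f - {n}) = 2" by simp
  then obtain a b where ab: "f - {n} = {a, b}" "a \<noteq> b"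
    by (auto simp: card_2_iff)
  then have fab: "f = {n, a, b}" and dist: "distinct [n, a, b]"
    using f' by auto
  obtain k where k: "face_vec fo {n, a, b} = (k / 2) *\<^sub>R cross3 (a - n) (b - n)" "\<bar>k\<bar> = 1"
  proof (rule face_vec_sign[of n a b fo])
    show "case fo {n, a, b} of (x, y, z) \<Rightarrow> {n, a, b} = {x, y, z}"
      using bspec[OF fo[unfolded face_orientation_def] f'(1)] unfolding fab .
  qed (rule dist)
  have normal: "face_vec fo f \<bullet> (x - y) = 0" if "x \<in> f" "y \<in> f" for x y
    using k(1) that unfolding fab by (rule inner_cross_triangle_eq_0)
  have nonzero: "face_vec fo f \<bullet> (barycenter c - barycenter f) \<noteq> 0" if c: "c \<in> cells_at C f" for c
  proof (rule cell_not_in_face_plane[OF grid f'(2) c _ normal])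
    obtain d where d: "c = insert d f" "d \<notin> f"
      using cell_containing_face[OF grid f'(2) c] .
    have cC: "c \<in> C" using c by (simp add: cells_at_def)
    have "c = {n, a, b, d}" using d fab by auto
    then have "cross3 (a - n) (b - n) \<bullet> (d - n) \<noteq> 0"
      using triple_product_nonzero card_cell[OF grid cC] independent_cell[OF grid cC] by blast
    then show "face_vec fo f \<noteq> 0"
      using k unfolding fab by auto
  qed
  have "l_vec C fo n f = (\<Sum>c\<in>cells_at C f.
      sgn (face_vec fo f \<bullet> (barycenter c - barycenter f)) *\<^sub>R (barycenter f - face_point n f))"
    unfolding l_vec_def by (intro sum.cong refl l_part_eq nonzero)
  also have "\<dots> = 0"
    using sum_sgn_side_eq_0[OF grid f'(1) barycenter_face_in_interior[OF grid int f] normal]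
    by (simp flip: scaleR_sum_left)
  finally show ?thesis .
qed

section \<open>Summation over all cells around the node\<close>

lemma finite_edges_faces_at:
  assumes "tetrahedral_grid \<Omega> C"
  shows "finite (edges_at C n)" "finite (faces_at C n)"
proof -
  have "finite (\<Union>c\<in>C. Pow c)"
    using finite_cells[OF assms] finite_cell[OF assms] by simp
  moreover have "edges_at C n \<subseteq> (\<Union>c\<in>C. Pow c)" "faces_at C n \<subseteq> (\<Union>c\<in>C. Pow c)"
    by (auto simp: edges_at_def grid_edges_def faces_at_def grid_faces_def)
  ultimately show "finite (edges_at C n)" "finite (faces_at C n)"
    using finite_subset by blast+
qed

text \<open>A cell that contains a simplex at n is itself a cell at n, so the inner sums can be
  taken over subsets of one fixed set of cells.\<close>

lemma sum_simplices_cells_swap: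
  fixes h :: "point set \<Rightarrow> point set \<Rightarrow> 'b::comm_monoid_add"
  assumes "finite C" "finite S" "\<And>s. s \<in> S \<Longrightarrow> n \<in> s"
  shows "(\<Sum>s\<in>S. \<Sum>c\<in>cells_at C s. h s c) = (\<Sum>c\<in>cells_at C {n}. \<Sum>s | s \<in> S \<and> s \<subseteq> c. h s c)"
proof -
  have "(\<Sum>s\<in>S. \<Sum>c\<in>cells_at C s. h s c) = (\<Sum>s\<in>S. \<Sum>c | c \<in> cells_at C {n} \<and> s \<subseteq> c. h s c)"
  proof (intro sum.cong refl)
    fix s assume "s \<in> S"
    then show "cells_at C s = {c. c \<in> cells_at C {n} \<and> s \<subseteq> c}"
      using assms(3) by (auto simp: cells_at_def)
  qed
  also have "\<dots> = (\<Sum>c\<in>cells_at C {n}. \<Sum>s | s \<in> S \<and> s \<subseteq> c. h s c)"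
    using assms by (intro sum.swap_restrict) (auto simp: cells_at_def)
  finally show ?thesis .
qed

text \<open>The boundary terms, zero in total, are added so that each cell separately contributes a
  multiple of u. The factor 2 is undone by the 1/2 in \<open>edge_matrix\<close>.\<close>

lemma sum_dual_face_edge:
  assumes grid: "tetrahedral_grid \<Omega> C" and eo: "edge_orientation C eo"
    and int: "dual_cell C n \<inter> frontier \<Omega> = {}"
  shows "(\<Sum>e\<in>edges_at C n. (dual_face_vec C eo e \<bullet> u) *\<^sub>R edge_vec eo e) =
    (2 * measure lebesgue (dual_cell C n)) *\<^sub>R u"
proof -
  have "(\<Sum>e\<in>edges_at C n. (dual_face_vec C eo e \<bullet> u) *\<^sub>R edge_vec eo e) =
    (\<Sum>e\<in>edges_at C n. ((dual_face_vec C eo e + s_vec C eo n e) \<bullet> u) *\<^sub>R edge_vec eo e)"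
    using s_vec_eq_0[OF grid eo int] by simp
  also have "\<dots> = (\<Sum>e\<in>edges_at C n. \<Sum>c\<in>cells_at C e.
      ((dual_face_part eo e c + s_part eo n e c) \<bullet> u) *\<^sub>R edge_vec eo e)"
    by (simp add: dual_face_vec_def s_vec_def inner_sum_left flip: sum.distrib scaleR_sum_left)
  also have "\<dots> = (\<Sum>c\<in>cells_at C {n}. \<Sum>e | e \<in> edges_at C n \<and> e \<subseteq> c.
      ((dual_face_part eo e c + s_part eo n e c) \<bullet> u) *\<^sub>R edge_vec eo e)"
    using finite_cells[OF grid] finite_edges_faces_at(1)[OF grid]
    by (rule sum_simplices_cells_swap) (simp add: edges_at_def)
  also have "\<dots> = (\<Sum>c\<in>cells_at C {n}. (measure lebesgue (convex hull c) / 2) *\<^sub>R u)"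
  proof (intro sum.cong refl)
    fix c assume "c \<in> cells_at C {n}"
    then have c: "c \<in> C" "n \<in> c" by (auto simp: cells_at_def)
    have set: "{e. e \<in> edges_at C n \<and> e \<subseteq> c} = {e. card e = 2 \<and> n \<in> e \<and> e \<subseteq> c}"
      using c by (auto simp: edges_at_def grid_edges_def)
    show "(\<Sum>e | e \<in> edges_at C n \<and> e \<subseteq> c.
      ((dual_face_part eo e c + s_part eo n e c) \<bullet> u) *\<^sub>R edge_vec eo e) =
      (measure lebesgue (convex hull c) / 2) *\<^sub>R u"
      unfolding set
    proof (rule sum_edge_cell_contributions[OF card_cell[OF grid c(1)] independent_cell[OF grid c(1)] c(2)])
      fix e assume "card e = 2" "e \<subseteq> c"
      then have "e \<in> grid_edges C" using c by (auto simp: grid_edges_def)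
      then show "case eo e of (x, y) \<Rightarrow> e = {x, y}"
        by (rule bspec[OF eo[unfolded edge_orientation_def]])
    qed
  qed
  also have "\<dots> = (2 * measure lebesgue (dual_cell C n)) *\<^sub>R u"
    unfolding measure_dual_cell[OF grid]
    by (simp add: sum_distrib_left flip: scaleR_sum_left)
  finally show ?thesis .
qed

text \<open>The analogue for faces, with the factor 3 undone by the 1/3 in
  \<open>face_matrix\<close>.\<close>

lemma sum_dual_edge_face:
  assumes grid: "tetrahedral_grid \<Omega> C" and fo: "face_orientation C fo"
    and int: "dual_cell C n \<inter> frontier \<Omega> = {}"
  shows "(\<Sum>f\<in>faces_at C n. (dual_edge_vec C fo f \<bullet> u) *\<^sub>R face_vec fo f) =
    (3 * measure lebesgue (dual_cell C n)) *\<^sub>R u"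
proof -
  have "(\<Sum>f\<in>faces_at C n. (dual_edge_vec C fo f \<bullet> u) *\<^sub>R face_vec fo f) =
    (\<Sum>f\<in>faces_at C n. ((dual_edge_vec C fo f + l_vec C fo n f) \<bullet> u) *\<^sub>R face_vec fo f)"
    using l_vec_eq_0[OF grid fo int] by simp
  also have "\<dots> = (\<Sum>f\<in>faces_at C n. \<Sum>c\<in>cells_at C f.
      ((dual_edge_part fo f c + l_part fo n f c) \<bullet> u) *\<^sub>R face_vec fo f)"
    by (simp add: dual_edge_vec_def l_vec_def inner_sum_left flip: sum.distrib scaleR_sum_left)
  also have "\<dots> = (\<Sum>c\<in>cells_at C {n}. \<Sum>f | f \<in> faces_at C n \<and> f \<subseteq> c.
      ((dual_edge_part fo f c + l_part fo n f c) \<bullet> u) *\<^sub>R face_vec fo f)"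
    using finite_cells[OF grid] finite_edges_faces_at(2)[OF grid]
    by (rule sum_simplices_cells_swap) (simp add: faces_at_def)
  also have "\<dots> = (\<Sum>c\<in>cells_at C {n}. (3 * measure lebesgue (convex hull c) / 4) *\<^sub>R u)"
  proof (intro sum.cong refl)
    fix c assume "c \<in> cells_at C {n}"
    then have c: "c \<in> C" "n \<in> c" by (auto simp: cells_at_def)
    have set: "{f. f \<in> faces_at C n \<and> f \<subseteq> c} = {f. card f = 3 \<and> n \<in> f \<and> f \<subseteq> c}"
      using c by (auto simp: faces_at_def grid_faces_def)
    show "(\<Sum>f | f \<in> faces_at C n \<and> f \<subseteq> c.
      ((dual_edge_part fo f c + l_part fo n f c) \<bullet> u) *\<^sub>R face_vec fo f) =
      (3 * measure lebesgue (convex hull c) / 4) *\<^sub>R u"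
      unfolding set
    proof (rule sum_face_cell_contributions[OF card_cell[OF grid c(1)] independent_cell[OF grid c(1)] c(2)])
      fix f assume "card f = 3" "f \<subseteq> c"
      then have "f \<in> grid_faces C" using c by (auto simp: grid_faces_def)
      then show "case fo f of (x, y, z) \<Rightarrow> f = {x, y, z}"
        by (rule bspec[OF fo[unfolded face_orientation_def]])
    qed
  qed
  also have "\<dots> = (3 * measure lebesgue (dual_cell C n)) *\<^sub>R u"
    unfolding measure_dual_cell[OF grid]
    by (simp add: sum_distrib_left flip: scaleR_sum_left)
  finally show ?thesis .
qed

lemma measure_dual_cell_pos:
  assumes grid: "tetrahedral_grid \<Omega> C" and n: "n \<in> grid_nodes C"
  shows "measure lebesgue (dual_cell C n) > 0"
  unfolding measure_dual_cell[OF grid]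
proof (rule sum_pos)
  show "finite (cells_at C {n})"
    using finite_cells[OF grid] by (simp add: cells_at_def)
  show "cells_at C {n} \<noteq> {}"
    using n by (auto simp: cells_at_def grid_nodes_def)
  show "0 < measure lebesgue (convex hull c) / 4" if "c \<in> cells_at C {n}" for c
    using that measure_simplex_pos[OF card_cell[OF grid] independent_cell[OF grid]]
    by (simp add: cells_at_def)
qed

lemma transpose_mult_eq_sum_rows:
  fixes A :: "real^'k^'m::finite"
  shows "transpose A *v y = (\<Sum>i\<in>UNIV. y $ i *\<^sub>R A $ i)"
  by (simp add: vec_eq_iff transpose_def matrix_vector_mult_def mult.commute del: transpose_matrix_vector)


theorem lemma6:
  fixes \<Omega> :: "point set"
    and C :: "point set set"
    and n :: "point"
    and eo :: "point set \<Rightarrow> point \<times> point"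
    and fo :: "point set \<Rightarrow> point \<times> point \<times> point"
    and ed :: "'me::finite \<Rightarrow> point set"
    and fa :: "'mf::finite \<Rightarrow> point set"
    and K :: "real^3^3"
    and \<alpha>F :: "real^'ke::finite"
    and \<alpha>E :: "real^'kf::finite"
    and wF :: "'ke \<Rightarrow> real^'me"
    and wE :: "'kf \<Rightarrow> real^'mf"
  assumes "tetrahedral_grid \<Omega> C"
    and "edge_orientation C eo"
    and "face_orientation C fo"
    and "n \<in> grid_nodes C"
    and "dual_cell C n \<inter> frontier \<Omega> = {}"
    and "bij_betw ed UNIV (edges_at C n)"
    and "bij_betw fa UNIV (faces_at C n)"
    and "symmetric_matrix K" and "pos_def_matrix K"
    and "CARD('ke) = card (edges_at C n) - 3"
    and "CARD('kf) = card (faces_at C n) - 3"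
    and "\<forall>i. \<alpha>F $ i > 0"
    and "\<forall>i. \<alpha>E $ i > 0"
    and "orthonormal_basis_of wF
           (orthogonal_comp (range ((*v) (dual_face_matrix C eo ed + s_matrix C eo n ed))))"
    and "orthonormal_basis_of wE
           (orthogonal_comp (range ((*v) (dual_edge_matrix C fo fa + l_matrix C fo n fa))))"
  shows "let vol = measure lebesgue (dual_cell C n);
             E = edge_matrix eo ed;
             F = face_matrix fo fa;
             WF = matrix_of_columns wF;
             WE = matrix_of_columns wE;
             MF = (1 / vol) *\<^sub>R (E ** K ** transpose E)
                  + WF ** diag_matrix \<alpha>F ** transpose WF;
             ME = (1 / vol) *\<^sub>R (F ** K ** transpose F)
                  + WE ** diag_matrix \<alpha>E ** transpose WE
         in symmetric_matrix MF \<and> consistent K E (dual_face_matrix C eo ed) MF \<and> pos_def_matrix MF \<and>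
            symmetric_matrix ME \<and> consistent K F (dual_edge_matrix C fo fa) ME \<and> pos_def_matrix ME"
proof -
  let ?vol = "measure lebesgue (dual_cell C n)"
  note grid = assms(1) and eo = assms(2) and fo = assms(3) and int = assms(5)
  have ed: "ed i \<in> edges_at C n" for i
    using bij_betwE[OF assms(6)] by simp
  have fa: "fa i \<in> faces_at C n" for i
    using bij_betwE[OF assms(7)] by simp
  have vol: "?vol > 0"
    by (rule measure_dual_cell_pos[OF grid assms(4)])
  \<comment> \<open>With vanishing boundary matrices, the given bases span the complements of the
    images of the dual matrices themselves, which is the form required by
    \<open>stabilized_matrix_properties\<close>.\<close>
  have "s_matrix C eo n ed = 0"
    using s_vec_eq_0[OF grid eo int ed] by (simp add: s_matrix_def vec_eq_iff)
  then have wF: "orthonormal_basis_of wF (orthogonal_comp (range ((*v) (dual_face_matrix C eo ed))))"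
    using assms(14) by simp
  have "l_matrix C fo n fa = 0"
    using l_vec_eq_0[OF grid fo int fa] by (simp add: l_matrix_def vec_eq_iff)
  then have wE: "orthonormal_basis_of wE (orthogonal_comp (range ((*v) (dual_edge_matrix C fo fa))))"
    using assms(15) by simp
  have F: "transpose (edge_matrix eo ed) *v (dual_face_matrix C eo ed *v u) = ?vol *\<^sub>R u" for u
  proof -
    have "transpose (edge_matrix eo ed) *v (dual_face_matrix C eo ed *v u) =
        (1/2) *\<^sub>R (\<Sum>i\<in>UNIV. (dual_face_vec C eo (ed i) \<bullet> u) *\<^sub>R edge_vec eo (ed i))"
      unfolding transpose_mult_eq_sum_rows
      by (simp add: edge_matrix_def dual_face_matrix_def matrix_vector_mul_component scaleR_sum_right)
    also have "\<dots> = (1/2) *\<^sub>R (\<Sum>e\<in>edges_at C n. (dual_face_vec C eo e \<bullet> u) *\<^sub>R edge_vec eo e)"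
      by (subst sum.reindex_bij_betw[OF assms(6)]) (rule refl)
    finally show ?thesis
      by (simp add: sum_dual_face_edge[OF grid eo int])
  qed
  have E: "transpose (face_matrix fo fa) *v (dual_edge_matrix C fo fa *v u) = ?vol *\<^sub>R u" for u
  proof -
    have "transpose (face_matrix fo fa) *v (dual_edge_matrix C fo fa *v u) =
        (1/3) *\<^sub>R (\<Sum>i\<in>UNIV. (dual_edge_vec C fo (fa i) \<bullet> u) *\<^sub>R face_vec fo (fa i))"
      unfolding transpose_mult_eq_sum_rows
      by (simp add: face_matrix_def dual_edge_matrix_def matrix_vector_mul_component scaleR_sum_right)
    also have "\<dots> = (1/3) *\<^sub>R (\<Sum>f\<in>faces_at C n. (dual_edge_vec C fo f \<bullet> u) *\<^sub>R face_vec fo f)"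
      by (subst sum.reindex_bij_betw[OF assms(7)]) (rule refl)
    finally show ?thesis
      by (simp add: sum_dual_edge_face[OF grid fo int])
  qed
  show ?thesis
    unfolding Let_def
    using stabilized_matrix_properties[OF vol F assms(8,9,12) wF]
      stabilized_matrix_properties[OF vol E assms(8,9,13) wE] by blast
qed

end
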